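(* Consider an adjoint consistent SBP-SAT discretization (as in the context) of the homogeneous diffusion problem, i.e. $\mathcal F=0$, $\mathcal U_D=0$, $\mathcal U_N=0$, for which $T^{(1)}_{ak},T^{(2)}_{ak},T^{(3)}_{ak},T^{(4)}_{ak},T^{(D)}_a$ are symmetric, $T^{(5)}_{abk}=(T^{(5)}_{bak})^T$, $T^{(6)}_{abk}=(T^{(6)}_{bak})^T$, $T^{(3)}_{\gamma k}-T^{(2)}_{\gamma k}=B_\gamma$, and $T^{(1)}_{ak}\succ0$. It is energy stable with respect to the diagonal norm matrix $H$ if the SAT coefficient matrices satisfy $$T^{(1)}_{\gamma k}-\frac2\zeta\Big(\frac1{\alpha_{\gamma k}}T^{(2)}_{\gamma k}\Upsilon_{\gamma\gamma k}T^{(2)}_{\gamma k}+\frac1{\alpha_{\gamma v}}T^{(2)}_{\gamma v}\Upsilon_{\gamma\gamma v}T^{(2)}_{\gamma v}\Big)\succeq0,$$ $$T^{(1)}_{ak}-64\,T^{(5)}_{abk}\big(T^{(1)}_{bk}\big)^{-1}T^{(5)}_{bak}\succeq0,$$ $$T^{(D)}_\gamma-\frac1{\alpha_{\gamma k}}B_\gamma\Upsilon_{\gamma\gamma k}B_\gamma\succeq0,\qquad T^{(4)}_{\gamma k}\succeq0,$$ where $a,b\in\{\gamma,\epsilon_1,\epsilon_2\}$ (distinct interior facets of $\Omega_k$), $\zeta=2$ for compact stencil SATs, i.e. SATs with $T^{(5)}_{abk}=T^{(6)}_{abk}=0$, and otherwise $\zeta=1$, and $\Upsilon_{abk}=N_{ak}^T\bar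 R_{ak}\bar H_k^{-1}\Lambda_k\bar R_{bk}^TN_{bk}$. The conditions are required for every element $\Omega_k$, every interior facet $\gamma$ (shared with $\Omega_v$), and, for the condition on $T_\gamma^{(D)}$, every Dirichlet facet.
   Context: **Problem.** $\Omega\subset\mathbb R^2$ is compact with piecewise smooth boundary $\Gamma^D\cup\Gamma^N$ ($\Gamma^D\ne\emptyset$), $\lambda$ a symmetric positive definite (SPD) $2\times2$ tensor field. $\partial_t\mathcal U-\nabla\cdot(\lambda\nabla\mathcal U)=\mathcal F$ in $\Omega$, $\mathcal U=\mathcal U_D$ on $\Gamma^D$, $(\lambda\nabla\mathcal U)\cdot n=\mathcal U_N$ on $\Gamma^N$. **Mesh.** $\Omega$ is partitioned into non-overlapping (possibly curved) triangles $\Omega_k$. $\Gamma_k$ denotes the facets (edges) of $\Omega_k$, $\Gamma_k^I$ those that are interior. For an interior facet $\gamma$ of $\Omega_k$, $\Omega_v$ is the neighbour across $\gamma$; $\epsilon\in\{\epsilon_1,\epsilon_2\}$ runs over the other interior facets of $\Omega_k$ (neighbour $\Omega_g$) and $\delta\in\{\delta_1,\delta_2\}$ over the other interior facets of $\Omega_v$ (neighbour $\Omega_q$). **Operators.** On $\Omega_k$ with $n_p$ volume nodes and $n_f$ nodes per facet: $H_k$ is a diagonal SPD matrix; $B_\gamma$ is the diagonal matrix of positive facet quadrature weights on $\gamma$ (common to both adjacent elements); $N_{x\gamma k},N_{y\gamma k}$ are the diagonal matrices of the components of the outward unit normal of $\Omega_k$ at the nodes of $\gamma$; $R_{\gamma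 k}\in\mathbb R^{n_f\times n_p}$ extrapolates from volume nodes to the nodes of $\gamma$; the derivative matrices satisfy the SBP property $H_kD_{xk}+(H_kD_{xk})^T=\sum_{\gamma\subset\Gamma_k}R_{\gamma k}^TB_\gamma N_{x\gamma k}R_{\gamma k}$ and similarly for $y$. $\Lambda_k$ is the SPD $2\times2$ block matrix with diagonal blocks holding the entries of $\lambda$ at the volume nodes. $N_{\gamma k}=\begin{bmatrix}N_{x\gamma k}\\ N_{y\gamma k}\end{bmatrix}$, $\bar R_{\gamma k}=\mathrm{diag}(R_{\gamma k},R_{\gamma k})$, $\bar H_k=\mathrm{diag}(H_k,H_k)$, $D^{(2)}_k=[D_{xk}\; D_{yk}]\Lambda_k\begin{bmatrix}D_{xk}\\ D_{yk}\end{bmatrix}$, $D_{\gamma k}=N_{\gamma k}^T\bar R_{\gamma k}\Lambda_k\begin{bmatrix}D_{xk}\\ D_{yk}\end{bmatrix}$. The facet weights $\alpha_{\gamma k}>0$ satisfy $\sum_{\gamma\subset\Gamma_k}\alpha_{\gamma k}=1$ for each $k$. **Discretization.** $\frac{du_{h,k}}{dt}=D^{(2)}_ku_{h,k}+f_k-H_k^{-1}s_k^I-H_k^{-1}s_k^B$, with $n_f\times n_f$ coefficient matrices $T$ and $$s_k^I=\sum_{\gamma\subset\Gamma_k^I}[R_{\gamma k}^T\; D_{\gamma k}^T]\begin{bmatrix}T^{(1)}_{\gamma k}&T^{(3)}_{\gamma k}\\ T^{(2)}_{\gamma k}&T^{(4)}_{\gamma k}\end{bmatrix}\begin{bmatrix}R_{\gamma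 k}u_{h,k}-R_{\gamma v}u_{h,v}\\ D_{\gamma k}u_{h,k}+D_{\gamma v}u_{h,v}\end{bmatrix}+\sum_{\gamma\subset\Gamma_k^I}\Big\{\sum_{\epsilon}R_{\gamma k}^TT^{(5)}_{\gamma\epsilon k}[R_{\epsilon k}u_{h,k}-R_{\epsilon g}u_{h,g}]+\sum_{\delta}R_{\gamma k}^TT^{(6)}_{\gamma\delta v}[R_{\delta v}u_{h,v}-R_{\delta q}u_{h,q}]\Big\},$$ $$s_k^B=\sum_{\gamma\subset\Gamma^D\cap\Gamma_k}[R_{\gamma k}^T\; D_{\gamma k}^T]\begin{bmatrix}T_\gamma^{(D)}\\ -B_\gamma\end{bmatrix}(R_{\gamma k}u_{h,k}-u_{\gamma k})+\sum_{\gamma\subset\Gamma^N\cap\Gamma_k}R_{\gamma k}^TB_\gamma(D_{\gamma k}u_{h,k}-w_{\gamma k}),$$ where $f_k,u_{\gamma k},w_{\gamma k}$ are nodal values of $\mathcal F$ and of the Dirichlet and Neumann data (all zero in the homogeneous case). **Adjoint consistent** is understood through the coefficient conditions $T^{(1)}_{\gamma k}=T^{(1)}_{\gamma v}$, $T^{(2)}_{\gamma k}+T^{(2)}_{\gamma v}=-B_\gamma$, $T^{(3)}_{\gamma k}+T^{(3)}_{\gamma v}=B_\gamma$, $T^{(4)}_{\gamma k}=T^{(4)}_{\gamma v}$, $T^{(5)}_{abk}=-T^{(6)}_{abk}$. **Energy stable** means $\frac{d}{dt}\sum_ku_{h,k}^TH_ku_{h,k}\le0$ for the semi-discrete solution.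 $Y\succeq0$ / $Y\succ0$ means positive semidefinite / definite. *)

theory Defs
  imports "HOL-Analysis.Analysis"
begin

(* "real ^ 'n ^ 'm" is the type of matrices with rows indexed by 'm and columns by 'n.
   A 2 x 2 block matrix has rows and columns indexed by sum types. *)

definition diag_mat :: "('n \<Rightarrow> real) \<Rightarrow> real ^ 'n ^ 'n" where
  "diag_mat d = (\<chi> i j. if i = j then d i else 0)"

(* Stacks vectors, and, with rows as entries, matrices. *)
definition vcat :: "'a ^ 'm \<Rightarrow> 'a ^ 'n \<Rightarrow> 'a ^ ('m + 'n)" where
  "vcat x y = (\<chi> i. case i of Inl a \<Rightarrow> x $ a | Inr b \<Rightarrow> y $ b)"

definition hcat :: "'a ^ 'm ^ 'r \<Rightarrow> 'a ^ 'n ^ 'r \<Rightarrow> 'a ^ ('m + 'n) ^ 'r" where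
  "hcat A B = (\<chi> i. vcat (A $ i) (B $ i))"

definition block_mat ::
    "real ^ 'n ^ 'm \<Rightarrow> real ^ 'q ^ 'm \<Rightarrow> real ^ 'n ^ 'r \<Rightarrow> real ^ 'q ^ 'r \<Rightarrow> real ^ ('n + 'q) ^ ('m + 'r)" where
  "block_mat A B C D = vcat (hcat A B) (hcat C D)"

definition double_mat :: "real ^ 'n ^ 'm \<Rightarrow> real ^ ('n + 'n) ^ ('m + 'm)" where
  "double_mat A = block_mat A 0 0 A"

definition sym_mat :: "real ^ 'n ^ 'n \<Rightarrow> bool" where
  "sym_mat A \<longleftrightarrow> transpose A = A"

(* Symmetry is not part of the next two notions; it is required separately where it is meant. *)
definition psd :: "real ^ 'n ^ 'n \<Rightarrow> bool" where
  "psd A \<longleftrightarrow> (\<forall>x. 0 \<le> x \<bullet> (A *v x))"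

definition pd :: "real ^ 'n ^ 'n \<Rightarrow> bool" where
  "pd A \<longleftrightarrow> (\<forall>x. x \<noteq> 0 \<longrightarrow> 0 < x \<bullet> (A *v x))"

definition spd :: "real ^ 'n ^ 'n \<Rightarrow> bool" where
  "spd A \<longleftrightarrow> sym_mat A \<and> pd A"


(* The data of  d/dt U - div (lam grad U) = src  in Omega,  U = dir  on GammaD,
   (lam grad U) . n = neu  on GammaN.  The first argument of src, dir and neu is time. *)

record diffusion_data =
  Omega :: "(real ^ 2) set"
  GammaD :: "(real ^ 2) set"
  GammaN :: "(real ^ 2) set"
  lam :: "real ^ 2 \<Rightarrow> real ^ 2 ^ 2"
  src :: "real \<Rightarrow> real ^ 2 \<Rightarrow> real"
  dir :: "real \<Rightarrow> real ^ 2 \<Rightarrow> real"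
  neu :: "real \<Rightarrow> real ^ 2 \<Rightarrow> real"

definition smooth_arc :: "(real \<Rightarrow> real ^ 2) \<Rightarrow> bool" where
  "smooth_arc c \<longleftrightarrow> arc c \<and> c C1_differentiable_on {0..1} \<and>
     (\<forall>s\<in>{0..1}. vector_derivative c (at s) \<noteq> 0)"

definition diffusion_problem :: "diffusion_data \<Rightarrow> bool" where
  "diffusion_problem P \<longleftrightarrow>
     compact (Omega P) \<and>
     frontier (Omega P) = GammaD P \<union> GammaN P \<and>
     (\<exists>C. finite C \<and> (\<forall>c\<in>C. smooth_arc c) \<and> frontier (Omega P) = (\<Union>c\<in>C. path_image c)) \<and>
     GammaD P \<noteq> {} \<and>
     (\<forall>x\<in>Omega P. spd (lam P x))"

definition homogeneous :: "diffusion_data \<Rightarrow> bool" where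
  "homogeneous P \<longleftrightarrow>
     src P = (\<lambda>t x. 0) \<and> dir P = (\<lambda>t x. 0) \<and> neu P = (\<lambda>t x. 0)"


record ('k, 'g) mesh =
  elems :: "'k set"
  elem_dom :: "'k \<Rightarrow> (real ^ 2) set"
  facets :: "'k \<Rightarrow> 'g set"
  curve :: "'g \<Rightarrow> real \<Rightarrow> real ^ 2"

definition all_facets :: "('k, 'g) mesh \<Rightarrow> 'g set" where
  "all_facets M = (\<Union>k\<in>elems M. facets M k)"

definition elems_at :: "('k, 'g) mesh \<Rightarrow> 'g \<Rightarrow> 'k set" where
  "elems_at M \<gamma> = {k \<in> elems M. \<gamma> \<in> facets M k}"

definition int_facets :: "('k, 'g) mesh \<Rightarrow> 'k \<Rightarrow> 'g set" where
  "int_facets M k = {\<gamma> \<in> facets M k. card (elems_at M \<gamma>) = 2}"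

definition bdry_facets :: "('k, 'g) mesh \<Rightarrow> 'k \<Rightarrow> 'g set" where
  "bdry_facets M k = {\<gamma> \<in> facets M k. card (elems_at M \<gamma>) = 1}"

definition neighbour :: "('k, 'g) mesh \<Rightarrow> 'g \<Rightarrow> 'k \<Rightarrow> 'k" where
  "neighbour M \<gamma> k = (THE v. v \<in> elems_at M \<gamma> \<and> v \<noteq> k)"

(* A boundary facet is classified by its points other than the two end points, since
   the latter may lie in the other part of the boundary. *)
definition dir_facets :: "diffusion_data \<Rightarrow> ('k, 'g) mesh \<Rightarrow> 'k \<Rightarrow> 'g set" where
  "dir_facets P M k = {\<gamma> \<in> bdry_facets M k. curve M \<gamma> ` {0<..<1} \<subseteq> GammaD P}"

definition neu_facets :: "diffusion_data \<Rightarrow> ('k, 'g) mesh \<Rightarrow> 'k \<Rightarrow> 'g set" where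
  "neu_facets P M k = {\<gamma> \<in> bdry_facets M k. curve M \<gamma> ` {0<..<1} \<subseteq> GammaN P}"

(* E is the set of the three edges, as point sets. *)
definition curved_triangle :: "(real ^ 2) set \<Rightarrow> (real ^ 2) set set \<Rightarrow> bool" where
  "curved_triangle S E \<longleftrightarrow>
     (\<exists>p q r \<phi> \<psi>. \<not> collinear {p, q, r :: real ^ 2} \<and>
        homeomorphism (convex hull {p, q, r}) S \<phi> \<psi> \<and>
        E = {\<phi> ` closed_segment p q, \<phi> ` closed_segment q r, \<phi> ` closed_segment r p})"

definition conforming_mesh :: "diffusion_data \<Rightarrow> ('k, 'g) mesh \<Rightarrow> bool" where
  "conforming_mesh P M \<longleftrightarrow>
     finite (elems M) \<and>
     Omega P = (\<Union>k\<in>elems M. elem_dom M k) \<and>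
     (\<forall>k\<in>elems M. \<forall>l\<in>elems M. k \<noteq> l \<longrightarrow>
        interior (elem_dom M k) \<inter> interior (elem_dom M l) = {}) \<and>
     (\<forall>k\<in>elems M. card (facets M k) = 3 \<and>
        curved_triangle (elem_dom M k) ((\<lambda>\<gamma>. path_image (curve M \<gamma>)) ` facets M k)) \<and>
     (\<forall>\<gamma>\<in>all_facets M. smooth_arc (curve M \<gamma>) \<and> card (elems_at M \<gamma>) \<in> {1, 2}) \<and>
     (\<forall>\<gamma>\<in>all_facets M. \<forall>\<eta>\<in>all_facets M. \<gamma> \<noteq> \<eta> \<longrightarrow>
        path_image (curve M \<gamma>) \<inter> path_image (curve M \<eta>) \<subseteq>
        {pathstart (curve M \<gamma>), pathfinish (curve M \<gamma>)} \<inter>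
        {pathstart (curve M \<eta>), pathfinish (curve M \<eta>)}) \<and>
     (\<forall>k\<in>elems M. bdry_facets M k = dir_facets P M k \<union> neu_facets P M k \<and>
        dir_facets P M k \<inter> neu_facets P M k = {})"

(* The outward unit normal of S along the arc c, as a function of the point.  At the end
   points, where S has a corner, it is determined by continuity. *)
definition outward_unit_normal ::
    "(real ^ 2) set \<Rightarrow> (real \<Rightarrow> real ^ 2) \<Rightarrow> (real ^ 2 \<Rightarrow> real ^ 2) \<Rightarrow> bool" where
  "outward_unit_normal S c \<nu> \<longleftrightarrow>
     continuous_on (path_image c) \<nu> \<and>
     (\<forall>s\<in>{0<..<1}. norm (\<nu> (c s)) = 1 \<and> \<nu> (c s) \<bullet> vector_derivative c (at s) = 0 \<and>
        (\<forall>\<^sub>F t in at_right 0. c s + t *\<^sub>R \<nu> (c s) \<notin> S) \<and>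
        (\<forall>\<^sub>F t in at_right 0. c s - t *\<^sub>R \<nu> (c s) \<in> S))"


(* 'p indexes the volume nodes of an element, 'f the nodes of a facet. *)

record ('k, 'g, 'p, 'f) sbp_data =
  vnode :: "'k \<Rightarrow> 'p \<Rightarrow> real ^ 2"
  fnode :: "'g \<Rightarrow> 'f \<Rightarrow> real ^ 2"
  normal :: "'g \<Rightarrow> 'k \<Rightarrow> real ^ 2 \<Rightarrow> real ^ 2"
  Hm :: "'k \<Rightarrow> real ^ 'p ^ 'p"
  Dx :: "'k \<Rightarrow> real ^ 'p ^ 'p"
  Dy :: "'k \<Rightarrow> real ^ 'p ^ 'p"
  Rm :: "'g \<Rightarrow> 'k \<Rightarrow> real ^ 'p ^ 'f"
  Bm :: "'g \<Rightarrow> real ^ 'f ^ 'f"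
  fwt :: "'g \<Rightarrow> 'k \<Rightarrow> real"  (* the facet weights alpha *)

definition Nx :: "('k, 'g, 'p::finite, 'f::finite) sbp_data \<Rightarrow> 'g \<Rightarrow> 'k \<Rightarrow> real ^ 'f ^ 'f" where
  "Nx S \<gamma> k = diag_mat (\<lambda>j. normal S \<gamma> k (fnode S \<gamma> j) $ 1)"

definition Ny :: "('k, 'g, 'p::finite, 'f::finite) sbp_data \<Rightarrow> 'g \<Rightarrow> 'k \<Rightarrow> real ^ 'f ^ 'f" where
  "Ny S \<gamma> k = diag_mat (\<lambda>j. normal S \<gamma> k (fnode S \<gamma> j) $ 2)"

definition sbp_operators ::
    "diffusion_data \<Rightarrow> ('k, 'g) mesh \<Rightarrow> ('k, 'g, 'p::finite, 'f::finite) sbp_data \<Rightarrow> bool" where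
  "sbp_operators P M S \<longleftrightarrow>
     (\<forall>k\<in>elems M.
        (\<forall>i. vnode S k i \<in> elem_dom M k) \<and>
        (\<exists>h. Hm S k = diag_mat h) \<and> spd (Hm S k) \<and>
        Hm S k ** Dx S k + transpose (Hm S k ** Dx S k) =
          (\<Sum>\<gamma>\<in>facets M k. transpose (Rm S \<gamma> k) ** Bm S \<gamma> ** Nx S \<gamma> k ** Rm S \<gamma> k) \<and>
        Hm S k ** Dy S k + transpose (Hm S k ** Dy S k) =
          (\<Sum>\<gamma>\<in>facets M k. transpose (Rm S \<gamma> k) ** Bm S \<gamma> ** Ny S \<gamma> k ** Rm S \<gamma> k) \<and>
        (\<forall>\<gamma>\<in>facets M k. outward_unit_normal (elem_dom M k) (curve M \<gamma>) (normal S \<gamma> k)) \<and>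
        (\<forall>\<gamma>\<in>facets M k. 0 < fwt S \<gamma> k) \<and> (\<Sum>\<gamma>\<in>facets M k. fwt S \<gamma> k) = 1) \<and>
     (\<forall>\<gamma>\<in>all_facets M.
        (\<forall>j. fnode S \<gamma> j \<in> path_image (curve M \<gamma>)) \<and>
        (\<exists>b. (\<forall>j. 0 < b j) \<and> Bm S \<gamma> = diag_mat b))"

definition Lam ::
    "diffusion_data \<Rightarrow> ('k, 'g, 'p::finite, 'f::finite) sbp_data \<Rightarrow> 'k \<Rightarrow> real ^ ('p + 'p) ^ ('p + 'p)" where
  "Lam P S k = block_mat
     (diag_mat (\<lambda>i. lam P (vnode S k i) $ 1 $ 1)) (diag_mat (\<lambda>i. lam P (vnode S k i) $ 1 $ 2))
     (diag_mat (\<lambda>i. lam P (vnode S k i) $ 2 $ 1)) (diag_mat (\<lambda>i. lam P (vnode S k i) $ 2 $ 2))"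

definition Nm :: "('k, 'g, 'p::finite, 'f::finite) sbp_data \<Rightarrow> 'g \<Rightarrow> 'k \<Rightarrow> real ^ 'f ^ ('f + 'f)" where
  "Nm S \<gamma> k = vcat (Nx S \<gamma> k) (Ny S \<gamma> k)"

definition D2 ::
    "diffusion_data \<Rightarrow> ('k, 'g, 'p::finite, 'f::finite) sbp_data \<Rightarrow> 'k \<Rightarrow> real ^ 'p ^ 'p" where
  "D2 P S k = hcat (Dx S k) (Dy S k) ** Lam P S k ** vcat (Dx S k) (Dy S k)"

definition Df ::
    "diffusion_data \<Rightarrow> ('k, 'g, 'p::finite, 'f::finite) sbp_data \<Rightarrow> 'g \<Rightarrow> 'k \<Rightarrow> real ^ 'p ^ 'f" where
  "Df P S \<gamma> k =
     transpose (Nm S \<gamma> k) ** double_mat (Rm S \<gamma> k) ** Lam P S k ** vcat (Dx S k) (Dy S k)"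

definition Upsilon ::
    "diffusion_data \<Rightarrow> ('k, 'g, 'p::finite, 'f::finite) sbp_data \<Rightarrow> 'g \<Rightarrow> 'g \<Rightarrow> 'k \<Rightarrow> real ^ 'f ^ 'f" where
  "Upsilon P S a b k =
     transpose (Nm S a k) ** double_mat (Rm S a k) ** matrix_inv (double_mat (Hm S k)) **
     Lam P S k ** transpose (double_mat (Rm S b k)) ** Nm S b k"


record ('k, 'g, 'f) sat_coeffs =
  T1 :: "'g \<Rightarrow> 'k \<Rightarrow> real ^ 'f ^ 'f"
  T2 :: "'g \<Rightarrow> 'k \<Rightarrow> real ^ 'f ^ 'f"
  T3 :: "'g \<Rightarrow> 'k \<Rightarrow> real ^ 'f ^ 'f"
  T4 :: "'g \<Rightarrow> 'k \<Rightarrow> real ^ 'f ^ 'f"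
  T5 :: "'g \<Rightarrow> 'g \<Rightarrow> 'k \<Rightarrow> real ^ 'f ^ 'f"
  T6 :: "'g \<Rightarrow> 'g \<Rightarrow> 'k \<Rightarrow> real ^ 'f ^ 'f"
  TD :: "'g \<Rightarrow> real ^ 'f ^ 'f"

definition adjoint_consistent ::
    "('k, 'g) mesh \<Rightarrow> ('k, 'g, 'p::finite, 'f::finite) sbp_data \<Rightarrow> ('k, 'g, 'f) sat_coeffs \<Rightarrow> bool" where
  "adjoint_consistent M S T \<longleftrightarrow>
     (\<forall>k\<in>elems M. \<forall>\<gamma>\<in>int_facets M k. let v = neighbour M \<gamma> k in
        T1 T \<gamma> k = T1 T \<gamma> v \<and>
        T2 T \<gamma> k + T2 T \<gamma> v = - Bm S \<gamma> \<and>
        T3 T \<gamma> k + T3 T \<gamma> v = Bm S \<gamma> \<and>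
        T4 T \<gamma> k = T4 T \<gamma> v) \<and>
     (\<forall>k\<in>elems M. \<forall>a\<in>int_facets M k. \<forall>b\<in>int_facets M k. a \<noteq> b \<longrightarrow>
        T5 T a b k = - T6 T a b k)"

definition compact_stencil :: "('k, 'g) mesh \<Rightarrow> ('k, 'g, 'f::finite) sat_coeffs \<Rightarrow> bool" where
  "compact_stencil M T \<longleftrightarrow>
     (\<forall>k\<in>elems M. \<forall>a\<in>int_facets M k. \<forall>b\<in>int_facets M k. a \<noteq> b \<longrightarrow>
        T5 T a b k = 0 \<and> T6 T a b k = 0)"

definition zeta :: "('k, 'g) mesh \<Rightarrow> ('k, 'g, 'f::finite) sat_coeffs \<Rightarrow> real" where
  "zeta M T = (if compact_stencil M T then 2 else 1)"


(* The grid function u assigns to each element its vector of nodal values. *)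

definition jump ::
    "('k, 'g) mesh \<Rightarrow> ('k, 'g, 'p::finite, 'f::finite) sbp_data \<Rightarrow> ('k \<Rightarrow> real ^ 'p) \<Rightarrow> 'g \<Rightarrow> 'k \<Rightarrow> real ^ 'f" where
  "jump M S u \<gamma> k =
     Rm S \<gamma> k *v u k - Rm S \<gamma> (neighbour M \<gamma> k) *v u (neighbour M \<gamma> k)"

definition flux_sum ::
    "diffusion_data \<Rightarrow> ('k, 'g) mesh \<Rightarrow> ('k, 'g, 'p::finite, 'f::finite) sbp_data \<Rightarrow> ('k \<Rightarrow> real ^ 'p) \<Rightarrow>
     'g \<Rightarrow> 'k \<Rightarrow> real ^ 'f" where
  "flux_sum P M S u \<gamma> k =
     Df P S \<gamma> k *v u k + Df P S \<gamma> (neighbour M \<gamma> k) *v u (neighbour M \<gamma> k)"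

definition sat_int ::
    "diffusion_data \<Rightarrow> ('k, 'g) mesh \<Rightarrow> ('k, 'g, 'p::finite, 'f::finite) sbp_data \<Rightarrow>
     ('k, 'g, 'f) sat_coeffs \<Rightarrow> ('k \<Rightarrow> real ^ 'p) \<Rightarrow> 'k \<Rightarrow> real ^ 'p" where
  "sat_int P M S T u k =
     (\<Sum>\<gamma>\<in>int_facets M k.
        hcat (transpose (Rm S \<gamma> k)) (transpose (Df P S \<gamma> k)) **
        block_mat (T1 T \<gamma> k) (T3 T \<gamma> k) (T2 T \<gamma> k) (T4 T \<gamma> k) *v
        vcat (jump M S u \<gamma> k) (flux_sum P M S u \<gamma> k)) +
     (\<Sum>\<gamma>\<in>int_facets M k. let v = neighbour M \<gamma> k in
        (\<Sum>\<epsilon>\<in>int_facets M k - {\<gamma>}. transpose (Rm S \<gamma> k) ** T5 T \<gamma> \<epsilon> k *v jump M S u \<epsilon> k) +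
        (\<Sum>\<delta>\<in>int_facets M v - {\<gamma>}. transpose (Rm S \<gamma> k) ** T6 T \<gamma> \<delta> v *v jump M S u \<delta> v))"

definition sat_bdry ::
    "diffusion_data \<Rightarrow> ('k, 'g) mesh \<Rightarrow> ('k, 'g, 'p::finite, 'f::finite) sbp_data \<Rightarrow>
     ('k, 'g, 'f) sat_coeffs \<Rightarrow> real \<Rightarrow> ('k \<Rightarrow> real ^ 'p) \<Rightarrow> 'k \<Rightarrow> real ^ 'p" where
  "sat_bdry P M S T t u k =
     (\<Sum>\<gamma>\<in>dir_facets P M k.
        hcat (transpose (Rm S \<gamma> k)) (transpose (Df P S \<gamma> k)) ** vcat (TD T \<gamma>) (- Bm S \<gamma>) *v
        (Rm S \<gamma> k *v u k - (\<chi> j. dir P t (fnode S \<gamma> j)))) +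
     (\<Sum>\<gamma>\<in>neu_facets P M k.
        transpose (Rm S \<gamma> k) ** Bm S \<gamma> *v
        (Df P S \<gamma> k *v u k - (\<chi> j. neu P t (fnode S \<gamma> j))))"

definition semidiscrete_rhs ::
    "diffusion_data \<Rightarrow> ('k, 'g) mesh \<Rightarrow> ('k, 'g, 'p::finite, 'f::finite) sbp_data \<Rightarrow>
     ('k, 'g, 'f) sat_coeffs \<Rightarrow> real \<Rightarrow> ('k \<Rightarrow> real ^ 'p) \<Rightarrow> 'k \<Rightarrow> real ^ 'p" where
  "semidiscrete_rhs P M S T t u k =
     D2 P S k *v u k + (\<chi> i. src P t (vnode S k i))
     - matrix_inv (Hm S k) *v sat_int P M S T u k
     - matrix_inv (Hm S k) *v sat_bdry P M S T t u k"

definition semidiscrete_solution ::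
    "diffusion_data \<Rightarrow> ('k, 'g) mesh \<Rightarrow> ('k, 'g, 'p::finite, 'f::finite) sbp_data \<Rightarrow>
     ('k, 'g, 'f) sat_coeffs \<Rightarrow> (real \<Rightarrow> 'k \<Rightarrow> real ^ 'p) \<Rightarrow> bool" where
  "semidiscrete_solution P M S T u \<longleftrightarrow>
     (\<forall>k\<in>elems M. \<forall>t\<ge>0.
        ((\<lambda>s. u s k) has_vector_derivative semidiscrete_rhs P M S T t (u t) k) (at t within {0..}))"

definition energy ::
    "('k, 'g) mesh \<Rightarrow> ('k, 'g, 'p::finite, 'f::finite) sbp_data \<Rightarrow> ('k \<Rightarrow> real ^ 'p) \<Rightarrow> real" where
  "energy M S u = (\<Sum>k\<in>elems M. u k \<bullet> (Hm S k *v u k))"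

definition energy_stable ::
    "diffusion_data \<Rightarrow> ('k, 'g) mesh \<Rightarrow> ('k, 'g, 'p::finite, 'f::finite) sbp_data \<Rightarrow>
     ('k, 'g, 'f) sat_coeffs \<Rightarrow> bool" where
  "energy_stable P M S T \<longleftrightarrow>
     (\<forall>u. semidiscrete_solution P M S T u \<longrightarrow>
        (\<forall>t\<ge>0. \<exists>d\<le>0. ((\<lambda>s. energy M S (u s)) has_real_derivative d) (at t within {0..})))"

end

theory Submission
  imports Defs
begin

text \<open>
  By the SBP property, half the derivative of the energy is minus the sum over the elements of
  \<open>G \<bullet> (H \<Lambda> G)\<close>, with \<open>G\<close> the discrete gradient, plus facet terms. Each element's volume term is
  split among its facets by the weights \<open>\<alpha>\<close>; completing the square with its share absorbs the
  cross terms between the fluxes \<open>D u\<close> and the facet values, at the price of a term in \<open>\<Upsilon>\<close>.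

  Summing the interior terms over both sides of a facet and using adjoint consistency, everything
  depends on the jumps \<open>J\<close> only, up to the terms \<open>2 (D u) \<bullet> (T2 J)\<close>, which are absorbed as above. The
  condition on \<open>T1\<close> then leaves the fraction \<open>(2 - \<zeta>) / 2\<close> of \<open>J \<bullet> (T1 J)\<close> per interior facet, which is
  half of it for extended stencils. The couplings \<open>J\<^sub>a \<bullet> (T5 J\<^sub>b)\<close> are at most
  \<open>(J\<^sub>a \<bullet> (T1 J\<^sub>a) + J\<^sub>b \<bullet> (T1 J\<^sub>b)) / 16\<close> by a weighted Young inequality; on a triangle each facet
  takes part in at most four ordered couplings, so the two elements at a facet use up exactly that half.
\<close>

section \<open>Matrix-vector products, transposes and inverses\<close>

lemma uminus_matrix_vector_mult:
  fixes A :: "real ^ 'n::finite ^ 'm::finite"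
  shows "(- A) *v x = - (A *v x)"
  by (simp add: vec_eq_iff matrix_vector_mult_def sum_negf)

lemma matrix_vector_mult_uminus:
  fixes A :: "real ^ 'n::finite ^ 'm::finite"
  shows "A *v (- x) = - (A *v x)"
  by (simp add: vec_eq_iff matrix_vector_mult_def sum_negf)

lemma inner_transpose:
  fixes A :: "real ^ 'n::finite ^ 'm::finite"
  shows "x \<bullet> (transpose A *v y) = (A *v x) \<bullet> y"
  using dot_lmul_matrix[of y A x] by (simp add: inner_commute)

lemma inner_sym_mat:
  assumes "sym_mat A"
  shows "x \<bullet> (A *v y) = (A *v x) \<bullet> y"
  using inner_transpose[of x A y] assms unfolding sym_mat_def by metis

lemma pd_imp_invertible:
  fixes A :: "real ^ 'n::finite ^ 'n"
  assumes "pd A"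
  shows "invertible A"
proof -
  have "x = 0" if "A *v x = 0" for x
    using assms that unfolding pd_def by (metis inner_zero_right less_irrefl)
  then show ?thesis
    using invertible_left_inverse matrix_left_invertible_ker by blast
qed

text \<open>\<open>matrix_inv\<close> is a choice among two-sided inverses, so invertibility alone
  supplies both identities.\<close>

lemma matrix_inv_cancel:
  fixes A :: "real ^ 'n::finite ^ 'n"
  assumes "invertible A"
  shows "A *v (matrix_inv A *v x) = x"
    and "matrix_inv A *v (A *v x) = x"
  using someI_ex[of "\<lambda>B. A ** B = mat 1 \<and> B ** A = mat 1"] assms
  unfolding matrix_inv_def[symmetric] invertible_def
  by (simp_all add: matrix_vector_mul_assoc)

section \<open>Block vectors and block matrices\<close>

lemma sum_UNIV_Plus:
  fixes f :: "'m::finite + 'n::finite \<Rightarrow> 'b::comm_monoid_add"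
  shows "(\<Sum>i\<in>UNIV. f i) = (\<Sum>i\<in>UNIV. f (Inl i)) + (\<Sum>i\<in>UNIV. f (Inr i))"
  by (simp add: UNIV_Plus_UNIV[symmetric] sum.Plus del: UNIV_Plus_UNIV)

lemma vcat_nth [simp]:
  "vcat x y $ Inl i = x $ i" "vcat x y $ Inr j = y $ j"
  by (simp_all add: vcat_def)

lemma vec_Plus_eqI:
  "(\<And>i. x $ Inl i = y $ Inl i) \<Longrightarrow> (\<And>j. x $ Inr j = y $ Inr j) \<Longrightarrow> x = y"
  by (metis (no_types) obj_sumE vec_eq_iff)

lemma vcat_mul [simp]: "vcat A B *v x = vcat (A *v x) (B *v x)"
  by (rule vec_Plus_eqI) (simp_all add: matrix_vector_mult_def)

lemma hcat_mul [simp]: "hcat A B *v vcat x y = A *v x + B *v y"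
  by (simp add: vec_eq_iff matrix_vector_mult_def hcat_def sum_UNIV_Plus)

lemma block_mat_mul [simp]:
  "block_mat A B C D *v vcat x y = vcat (A *v x + B *v y) (C *v x + D *v y)"
  by (simp add: block_mat_def)

lemma double_mat_mul [simp]: "double_mat A *v vcat x y = vcat (A *v x) (A *v y)"
  by (simp add: double_mat_def)

lemma inner_vcat [simp]:
  fixes a c :: "real ^ 'm::finite" and b d :: "real ^ 'n::finite"
  shows "vcat a b \<bullet> vcat c d = a \<bullet> c + b \<bullet> d"
  by (simp add: inner_vec_def sum_UNIV_Plus)

lemma vcat_cases:
  obtains a b where "x = vcat a b"
proof
  show "x = vcat (\<chi> i. x $ Inl i) (\<chi> i. x $ Inr i)"
    by (rule vec_Plus_eqI) simp_all
qed

lemma transpose_vcat_mul [simp]: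
  "transpose (vcat A B) *v vcat x y = transpose A *v x + transpose B *v (y :: real ^ 'n::finite)"
  by (simp add: vec_eq_iff matrix_vector_mult_def transpose_def sum_UNIV_Plus)

section \<open>Diagonal and definite matrices, completing the square\<close>

lemma diag_mat_mul: "(diag_mat d *v x) $ i = d i * x $ i"
  by (simp add: matrix_vector_mult_def diag_mat_def if_distrib[of "\<lambda>c. c * _"] cong: if_cong)

lemma transpose_diag_mat [simp]: "transpose (diag_mat d) = diag_mat d"
  by (simp add: transpose_def diag_mat_def vec_eq_iff)

lemma sym_mat_diag_mat: "sym_mat (diag_mat d)"
  by (simp add: sym_mat_def)

lemma pd_diag_mat_pos:
  assumes "pd (diag_mat d)"
  shows "0 < d i"
proof -
  have "0 < axis i 1 \<bullet> (diag_mat d *v axis i 1)"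
    using assms unfolding pd_def by (metis axis_eq_0_iff zero_neq_one)
  then show ?thesis
    by (simp add: inner_axis' diag_mat_mul)
qed

lemma pd_double_mat:
  assumes "pd A"
  shows "pd (double_mat A)"
  unfolding pd_def
proof (intro allI impI)
  fix x :: "real ^ ('a + 'a)"
  assume "x \<noteq> 0"
  obtain a b where x: "x = vcat a b" by (rule vcat_cases)
  have "a \<noteq> 0 \<or> b \<noteq> 0"
    using \<open>x \<noteq> 0\<close> unfolding x by (auto intro!: vec_Plus_eqI)
  moreover have "0 \<le> a \<bullet> (A *v a)" "0 \<le> b \<bullet> (A *v b)"
    using assms unfolding pd_def by (metis inner_zero_left less_eq_real_def)+
  ultimately show "0 < x \<bullet> (double_mat A *v x)"
    using assms unfolding x pd_def by (auto intro: add_pos_nonneg add_nonneg_pos)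
qed

text \<open>The form is written out in entries because \<open>Lam\<close> stores the tensor
  entrywise; it applies at each volume node.\<close>

lemma pd_2x2_form_nonneg:
  fixes A :: "real ^ 2 ^ 2"
  assumes "pd A"
  shows "0 \<le> a * (A $ 1 $ 1 * a + A $ 1 $ 2 * b) + b * (A $ 2 $ 1 * a + A $ 2 $ 2 * b)"
proof -
  have "0 \<le> vector [a, b] \<bullet> (A *v vector [a, b])"
    using assms unfolding pd_def by (metis inner_zero_left less_eq_real_def)
  then show ?thesis
    by (simp add: inner_vec_def matrix_vector_mult_def sum_2)
qed

text \<open>The form of \<open>K L\<close> is evaluated at \<open>c g + y\<close> with
  \<open>y\<close> the solution of \<open>K y = z\<close>, and the result is divided by
  \<open>c\<close>. Commutation and symmetry of both factors merge the two cross terms and turn the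
  form of \<open>y\<close> into the last summand. In the application \<open>K\<close> is the doubled
  norm matrix and \<open>L\<close> the tensor.\<close>

lemma complete_square:
  fixes K L :: "real ^ 'n::finite ^ 'n"
  assumes K: "invertible K" "sym_mat K"
    and comm: "\<And>x. K *v (L *v x) = L *v (K *v x)"
    and L: "sym_mat L"
    and nonneg: "\<And>x. 0 \<le> x \<bullet> (K *v (L *v x))"
    and "0 < c"
  shows "0 \<le> c * (g \<bullet> (K *v (L *v g))) + 2 * ((L *v g) \<bullet> z) + (1 / c) * (z \<bullet> (matrix_inv K *v (L *v z)))"
proof -
  define y where "y = matrix_inv K *v z"
  have Ky: "K *v y = z"
    by (simp add: y_def matrix_inv_cancel K)
  have inv: "matrix_inv K *v (L *v z) = L *v y"
    by (simp add: Ky[symmetric] comm[symmetric] matrix_inv_cancel K)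
  have 1: "g \<bullet> (K *v (L *v y)) = (L *v g) \<bullet> z" "y \<bullet> (K *v (L *v g)) = (L *v g) \<bullet> z"
    "y \<bullet> (K *v (L *v y)) = z \<bullet> (L *v y)"
    using inner_sym_mat[OF L, of g z] inner_sym_mat[OF K(2), of y "L *v g"] inner_sym_mat[OF K(2), of y "L *v y"]
    by (simp_all add: comm[of y] Ky inner_commute)
  have "0 \<le> (c *\<^sub>R g + y) \<bullet> (K *v (L *v (c *\<^sub>R g + y)))"
    by (rule nonneg)
  also have "\<dots> = c * (c * (g \<bullet> (K *v (L *v g))) + 2 * ((L *v g) \<bullet> z) + (1 / c) * (z \<bullet> (L *v y)))"
    using \<open>0 < c\<close>
    by (simp add: matrix_vector_right_distrib matrix_vector_mult_scaleR inner_add_left inner_add_right 1 algebra_simps)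
  finally show ?thesis
    using \<open>0 < c\<close> by (simp add: inv zero_le_mult_iff)
qed

section \<open>Interior facets and their two elements\<close>

text \<open>Exactly two elements share an interior facet, so the definite description in
  \<open>neighbour\<close> is meaningful from either side and crossing the facet is an
  involution.\<close>

lemma neighbour_int_facet:
  assumes "k \<in> elems M" "\<gamma> \<in> int_facets M k"
  shows "neighbour M \<gamma> k \<in> elems M" "\<gamma> \<in> int_facets M (neighbour M \<gamma> k)"
    "neighbour M \<gamma> (neighbour M \<gamma> k) = k"
proof -
  have k: "k \<in> elems_at M \<gamma>" and "card (elems_at M \<gamma>) = 2"
    using assms by (auto simp: elems_at_def int_facets_def)
  then obtain v where v: "elems_at M \<gamma> = {k, v}" "k \<noteq> v"
    by (metis card_2_iff doubleton_eq_iff insertE singletonD)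
  then have n: "neighbour M \<gamma> k = v" "neighbour M \<gamma> v = k"
    unfolding neighbour_def by (auto intro!: the_equality)
  have "v \<in> elems_at M \<gamma>" using v by simp
  then show "neighbour M \<gamma> k \<in> elems M" "\<gamma> \<in> int_facets M (neighbour M \<gamma> k)"
    "neighbour M \<gamma> (neighbour M \<gamma> k) = k"
    using \<open>card (elems_at M \<gamma>) = 2\<close> by (simp_all add: n elems_at_def int_facets_def)
qed

text \<open>Crossing the facet permutes the pairs of an element and one of its interior facets, so
  it only reindexes the double sum.\<close>

lemma sum_int_facets_swap:
  fixes f :: "'g \<Rightarrow> 'k \<Rightarrow> real"
  assumes "finite (elems M)" "\<And>k. k \<in> elems M \<Longrightarrow> finite (facets M k)"
  shows "(\<Sum>k\<in>elems M. \<Sum>\<gamma>\<in>int_facets M k. f \<gamma> (neighbour M \<gamma> k)) =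
    (\<Sum>k\<in>elems M. \<Sum>\<gamma>\<in>int_facets M k. f \<gamma> k)"
proof -
  have "\<forall>k\<in>elems M. finite (int_facets M k)"
    using assms(2) by (simp add: int_facets_def)
  then show ?thesis
    using assms(1)
    by (simp add: sum.Sigma)
      (rule sum.reindex_bij_witness[where i = "\<lambda>(k, \<gamma>). (neighbour M \<gamma> k, \<gamma>)"
          and j = "\<lambda>(k, \<gamma>). (neighbour M \<gamma> k, \<gamma>)"]; auto simp: neighbour_int_facet)
qed

text \<open>The interior estimates hold only for both sides of a facet together. Adding the two
  sides under the sum doubles each total, by the reindexing above, and the factor 2 cancels.\<close>

lemma sum_int_facets_pair_mono:
  fixes f g :: "'g \<Rightarrow> 'k \<Rightarrow> real"
  assumes fin: "finite (elems M)" "\<And>k. k \<in> elems M \<Longrightarrow> finite (facets M k)"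
    and le: "\<And>k \<gamma>. k \<in> elems M \<Longrightarrow> \<gamma> \<in> int_facets M k \<Longrightarrow>
      f \<gamma> k + f \<gamma> (neighbour M \<gamma> k) \<le> g \<gamma> k + g \<gamma> (neighbour M \<gamma> k)"
  shows "(\<Sum>k\<in>elems M. \<Sum>\<gamma>\<in>int_facets M k. f \<gamma> k) \<le> (\<Sum>k\<in>elems M. \<Sum>\<gamma>\<in>int_facets M k. g \<gamma> k)"
proof -
  have "(\<Sum>k\<in>elems M. \<Sum>\<gamma>\<in>int_facets M k. f \<gamma> k + f \<gamma> (neighbour M \<gamma> k)) \<le>
      (\<Sum>k\<in>elems M. \<Sum>\<gamma>\<in>int_facets M k. g \<gamma> k + g \<gamma> (neighbour M \<gamma> k))"
    by (intro sum_mono le)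
  then show ?thesis
    using sum_int_facets_swap[OF fin, of f] sum_int_facets_swap[OF fin, of g]
    by (simp add: sum.distrib)
qed

section \<open>Element operators, the diffusion tensor and normal fluxes\<close>

lemma inner_hcat_transpose:
  fixes A :: "real ^ 'n::finite ^ 'm::finite" and B :: "real ^ 'n ^ 'r::finite"
  shows "x \<bullet> (hcat (transpose A) (transpose B) *v vcat y z) = (A *v x) \<bullet> y + (B *v x) \<bullet> z"
  unfolding hcat_mul inner_add_right inner_transpose ..

definition grad :: "('k, 'g, 'p::finite, 'f::finite) sbp_data \<Rightarrow> 'k \<Rightarrow> real ^ 'p \<Rightarrow> real ^ ('p + 'p)" where
  "grad S k x = vcat (Dx S k) (Dy S k) *v x"

text \<open>Discrete counterpart of the integral of \<nabla>U . (\<lambda>\<nabla>U) over the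
  element, hence a squared norm. It is the dissipation that the element has to offer.\<close>

definition grad_norm ::
    "diffusion_data \<Rightarrow> ('k, 'g, 'p::finite, 'f::finite) sbp_data \<Rightarrow> 'k \<Rightarrow> real ^ 'p \<Rightarrow> real" where
  "grad_norm P S k x = grad S k x \<bullet> (double_mat (Hm S k) *v (Lam P S k *v grad S k x))"

lemma Lam_mul:
  "Lam P S k *v vcat x y =
    vcat (\<chi> i. lam P (vnode S k i) $ 1 $ 1 * x $ i + lam P (vnode S k i) $ 1 $ 2 * y $ i)
         (\<chi> i. lam P (vnode S k i) $ 2 $ 1 * x $ i + lam P (vnode S k i) $ 2 $ 2 * y $ i)"
  unfolding Lam_def block_mat_mul by (simp add: vcat_def vec_eq_iff diag_mat_mul split: sum.split)

text \<open>At each node the tensor acts as a 2 x 2 matrix on the two components, while the doubled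
  diagonal matrix multiplies both by the same scalar.\<close>

lemma Lam_commute:
  "double_mat (diag_mat h) *v (Lam P S k *v x) = Lam P S k *v (double_mat (diag_mat h) *v x)"
proof -
  obtain a b where "x = vcat a b" by (rule vcat_cases)
  then show ?thesis
    by (simp add: Lam_mul) (simp add: vcat_def vec_eq_iff diag_mat_mul algebra_simps split: sum.split)
qed

text \<open>The form is a sum over the volume nodes of the quadratic form of the tensor at the node,
  times a positive weight.\<close>

lemma Lam_weighted_nonneg:
  assumes "\<And>i. 0 < h i" "\<And>i. pd (lam P (vnode S k i))"
  shows "0 \<le> x \<bullet> (double_mat (diag_mat h) *v (Lam P S k *v x))"
proof -
  obtain a b where x: "x = vcat a b" by (rule vcat_cases)
  have "0 \<le> h i * (a $ i * (lam P (vnode S k i) $ 1 $ 1 * a $ i + lam P (vnode S k i) $ 1 $ 2 * b $ i)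
      + b $ i * (lam P (vnode S k i) $ 2 $ 1 * a $ i + lam P (vnode S k i) $ 2 $ 2 * b $ i))" for i
    using assms(1)[of i] pd_2x2_form_nonneg[OF assms(2)[of i], of "a $ i" "b $ i"] by simp
  then show ?thesis
    unfolding x Lam_mul double_mat_mul inner_vcat
    by (simp add: inner_vec_def diag_mat_mul sum.distrib[symmetric] mult.assoc[symmetric])
      (rule sum_nonneg, simp add: algebra_simps)
qed

lemma sym_mat_Lam:
  assumes "\<And>i. sym_mat (lam P (vnode S k i))"
  shows "sym_mat (Lam P S k)"
proof -
  have "lam P (vnode S k i) $ 1 $ 2 = lam P (vnode S k i) $ 2 $ 1" for i
    using assms[of i] by (simp add: sym_mat_def transpose_def vec_eq_iff)
  then show ?thesis
    by (auto simp: sym_mat_def transpose_def vec_eq_iff Lam_def block_mat_def hcat_def vcat_def diag_mat_def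
        split: sum.split)
qed

lemma sym_mat_double_diag: "sym_mat (double_mat (diag_mat h))"
  by (auto simp: sym_mat_def transpose_def vec_eq_iff double_mat_def block_mat_def hcat_def vcat_def diag_mat_def
      split: sum.split)

text \<open>Positive definiteness of the diagonal norm matrix makes its entries positive; the tensor
  is SPD at the volume nodes because these lie in \<open>Omega\<close>.\<close>

lemma sbp_elementD:
  assumes "diffusion_problem P" "conforming_mesh P M" "sbp_operators P M S" "k \<in> elems M"
  shows "\<exists>h. Hm S k = diag_mat h \<and> (\<forall>i. 0 < h i)"
    and "pd (Hm S k)" and "sym_mat (Hm S k)"
    and "spd (lam P (vnode S k i))"
proof -
  show H: "pd (Hm S k)" "sym_mat (Hm S k)"
    using assms(3,4) unfolding sbp_operators_def spd_def by blast+
  obtain h where h: "Hm S k = diag_mat h"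
    using assms(3,4) unfolding sbp_operators_def by blast
  then have "0 < h i" for i
    using pd_diag_mat_pos[of h i] H(1) by simp
  then show "\<exists>h. Hm S k = diag_mat h \<and> (\<forall>i. 0 < h i)"
    using h by blast
  have "vnode S k i \<in> Omega P"
  proof -
    have "vnode S k i \<in> elem_dom M k"
      using assms(3,4) unfolding sbp_operators_def by blast
    moreover have "Omega P = (\<Union>k\<in>elems M. elem_dom M k)"
      using assms(2) unfolding conforming_mesh_def by (elim conjE)
    ultimately show ?thesis
      using assms(4) by blast
  qed
  then show "spd (lam P (vnode S k i))"
    using assms(1) by (simp add: diffusion_problem_def)
qed

lemma Df_mul: "Df P S \<gamma> k *v x =
    transpose (Nm S \<gamma> k) *v (double_mat (Rm S \<gamma> k) *v (Lam P S k *v grad S k x))"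
  by (simp only: Df_def grad_def matrix_vector_mul_assoc matrix_mul_assoc)

lemma grad_norm_nonneg:
  assumes "diffusion_problem P" "conforming_mesh P M" "sbp_operators P M S" "k \<in> elems M"
  shows "0 \<le> grad_norm P S k x"
proof -
  obtain h where "Hm S k = diag_mat h" "\<And>i. 0 < h i"
    using sbp_elementD(1)[OF assms] by blast
  then show ?thesis
    using sbp_elementD(4)[OF assms]
    by (auto simp: grad_norm_def spd_def intro!: Lam_weighted_nonneg)
qed

text \<open>The flux \<open>Df *v x\<close> is linear in the tensor applied to the gradient. Pairing
  it with \<open>w\<close> equals pairing that vector with \<open>z\<close>, the lift of
  \<open>w\<close> to the volume nodes by the adjoint of normal extrapolation. Completing the square
  then leaves the form of \<open>Upsilon\<close> as the price. The constant \<open>c\<close> will be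
  the weight \<alpha> of the facet.\<close>

lemma facet_square_nonneg:
  assumes "diffusion_problem P" "conforming_mesh P M" "sbp_operators P M S" "k \<in> elems M"
    and "0 < c"
  shows "0 \<le> c * grad_norm P S k x + 2 * ((Df P S \<gamma> k *v x) \<bullet> w) +
    (1 / c) * (w \<bullet> (Upsilon P S \<gamma> \<gamma> k *v w))"
proof -
  obtain h where h: "Hm S k = diag_mat h" "\<And>i. 0 < h i"
    using sbp_elementD(1)[OF assms(1-4)] by blast
  define K where "K = double_mat (Hm S k)"
  define z where "z = transpose (double_mat (Rm S \<gamma> k)) *v (Nm S \<gamma> k *v w)"
  have dual: "(transpose (Nm S \<gamma> k) *v (double_mat (Rm S \<gamma> k) *v y)) \<bullet> w = y \<bullet> z" for y
    using inner_transpose[of w "Nm S \<gamma> k" "double_mat (Rm S \<gamma> k) *v y"]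
      inner_transpose[of y "double_mat (Rm S \<gamma> k)" "Nm S \<gamma> k *v w"]
    by (simp only: z_def inner_commute)
  have "0 \<le> c * (grad S k x \<bullet> (K *v (Lam P S k *v grad S k x))) +
      2 * ((Lam P S k *v grad S k x) \<bullet> z) + (1 / c) * (z \<bullet> (matrix_inv K *v (Lam P S k *v z)))"
  proof (rule complete_square)
    show "invertible K" "sym_mat K"
      unfolding K_def h(1)
      using pd_imp_invertible[OF pd_double_mat] sbp_elementD(2)[OF assms(1-4)] sym_mat_double_diag
      by (simp_all only: h(1))
    show "sym_mat (Lam P S k)"
      using sbp_elementD(4)[OF assms(1-4)] by (auto simp: spd_def intro!: sym_mat_Lam)
    show "K *v (Lam P S k *v x) = Lam P S k *v (K *v x)" for x
      by (simp add: K_def h(1) Lam_commute)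
    show "0 \<le> x \<bullet> (K *v (Lam P S k *v x))" for x
      using sbp_elementD(4)[OF assms(1-4)] h(2)
      by (auto simp: K_def h(1) spd_def intro!: Lam_weighted_nonneg)
  qed fact
  moreover have "(Df P S \<gamma> k *v x) \<bullet> w = (Lam P S k *v grad S k x) \<bullet> z"
    by (simp only: Df_mul dual)
  moreover have "w \<bullet> (Upsilon P S \<gamma> \<gamma> k *v w) = z \<bullet> (matrix_inv K *v (Lam P S k *v z))"
  proof -
    have "Upsilon P S \<gamma> \<gamma> k *v w = transpose (Nm S \<gamma> k) *v (double_mat (Rm S \<gamma> k) *v
        (matrix_inv K *v (Lam P S k *v z)))"
      by (simp only: Upsilon_def K_def z_def matrix_vector_mul_assoc matrix_mul_assoc)
    then show ?thesis
      by (simp only: inner_commute[of w] inner_commute[of z] dual)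
  qed
  ultimately show ?thesis
    by (simp add: grad_norm_def K_def)
qed

section \<open>Summation by parts on an element\<close>

lemma sum_mat_mul:
  fixes A :: "'i \<Rightarrow> real ^ 'n::finite ^ 'm::finite"
  shows "(\<Sum>i\<in>I. A i) *v x = (\<Sum>i\<in>I. A i *v x)"
  by (induction I rule: infinite_finite_induct) (simp_all add: matrix_vector_mult_add_rdistrib)

text \<open>Integration by parts in one coordinate direction: the transposed half of the SBP
  identity moves the derivative to \<open>x\<close>, and symmetry of \<open>H\<close> moves the norm
  matrix back to \<open>y\<close>.\<close>

lemma sbp_integration_by_parts:
  fixes Q D :: "real ^ 'n::finite ^ 'n"
  assumes "sym_mat H"
    and "H ** D + transpose (H ** D) = (\<Sum>i\<in>I. transpose (R i) ** B i ** N i ** R i)"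
  shows "x \<bullet> (H *v (D *v y)) =
    - ((D *v x) \<bullet> (H *v y)) + (\<Sum>i\<in>I. (R i *v x) \<bullet> (B i *v (N i *v (R i *v y))))"
proof -
  have "x \<bullet> ((H ** D + transpose (H ** D)) *v y) = x \<bullet> (H *v (D *v y)) + (D *v x) \<bullet> (H *v y)"
    using inner_sym_mat[OF assms(1)]
    by (simp only: matrix_vector_mult_add_rdistrib inner_add_right inner_transpose
        matrix_vector_mul_assoc[symmetric])
  moreover have "x \<bullet> ((\<Sum>i\<in>I. transpose (R i) ** B i ** N i ** R i) *v y) =
      (\<Sum>i\<in>I. (R i *v x) \<bullet> (B i *v (N i *v (R i *v y))))"
    by (simp only: sum_mat_mul inner_sum_right matrix_vector_mul_assoc[symmetric] inner_transpose)
  ultimately show ?thesis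
    using assms(2) by simp
qed

text \<open>Summation by parts is applied to each component of the flux vector
  \<open>vcat q1 q2\<close>. The volume parts add up to \<open>grad_norm\<close>, and the two normal
  components on a facet recombine into the normal flux \<open>Df\<close>.\<close>

lemma volume_term:
  assumes "diffusion_problem P" "conforming_mesh P M" "sbp_operators P M S" "k \<in> elems M"
  shows "x \<bullet> (Hm S k *v (D2 P S k *v x)) =
    - grad_norm P S k x + (\<Sum>\<gamma>\<in>facets M k. (Rm S \<gamma> k *v x) \<bullet> (Bm S \<gamma> *v (Df P S \<gamma> k *v x)))"
proof -
  note H = sbp_elementD(3)[OF assms]
  have parts:
    "Hm S k ** Dx S k + transpose (Hm S k ** Dx S k) =
      (\<Sum>\<gamma>\<in>facets M k. transpose (Rm S \<gamma> k) ** Bm S \<gamma> ** Nx S \<gamma> k ** Rm S \<gamma> k)"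
    "Hm S k ** Dy S k + transpose (Hm S k ** Dy S k) =
      (\<Sum>\<gamma>\<in>facets M k. transpose (Rm S \<gamma> k) ** Bm S \<gamma> ** Ny S \<gamma> k ** Rm S \<gamma> k)"
    using assms(3,4) unfolding sbp_operators_def by blast+
  obtain q1 q2 where q: "Lam P S k *v grad S k x = vcat q1 q2"
    by (rule vcat_cases)
  have "D2 P S k *v x = Dx S k *v q1 + Dy S k *v q2"
    by (simp only: D2_def matrix_vector_mul_assoc[symmetric] q[unfolded grad_def] hcat_mul)
  moreover have "Df P S \<gamma> k *v x = Nx S \<gamma> k *v (Rm S \<gamma> k *v q1) + Ny S \<gamma> k *v (Rm S \<gamma> k *v q2)" for \<gamma>
    by (simp only: Df_mul q double_mat_mul Nm_def transpose_vcat_mul) (simp only: Nx_def Ny_def transpose_diag_mat)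
  moreover have "grad_norm P S k x = (Dx S k *v x) \<bullet> (Hm S k *v q1) + (Dy S k *v x) \<bullet> (Hm S k *v q2)"
    by (simp only: grad_norm_def q double_mat_mul) (simp add: grad_def)
  ultimately show ?thesis
    by (simp add: matrix_vector_right_distrib inner_add_right sum.distrib
        sbp_integration_by_parts[OF H parts(1)] sbp_integration_by_parts[OF H parts(2)])
qed

section \<open>Estimates for facet pairs and facet couplings\<close>

text \<open>Primes mark the neighbour, which sees the jump \<open>- j\<close> and the same flux sum.
  The terms with factor 2 are what the completed squares contribute. Once \<open>B\<close>,
  \<open>A3\<close> and \<open>A3'\<close> are expressed by \<open>A2\<close> and
  \<open>A2'\<close>, every product of a facet value with a flux cancels between the two
  sides.\<close>

lemma facet_pair_identity:
  fixes B :: "real ^ 'f::finite ^ 'f"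
  assumes sym: "sym_mat A2" "sym_mat A2'"
    and A: "A2 + A2' = - B" "A3 + A3' = B" "A3 - A2 = B"
    and j: "j = r - r'" and f: "f = d + d'"
  shows "(2 * (d \<bullet> (A2 *v j)) + r \<bullet> (B *v d) - (r \<bullet> (A1 *v j + A3 *v f) + d \<bullet> (A2 *v j + A4 *v f))) +
    (2 * (d' \<bullet> (A2' *v - j)) + r' \<bullet> (B *v d') - (r' \<bullet> (A1 *v - j + A3' *v f) + d' \<bullet> (A2' *v - j + A4 *v f)))
    = - (j \<bullet> (A1 *v j)) - f \<bullet> (A4 *v f)"
proof -
  have eqs: "B = - A2 - A2'" "A3 = - A2'" "A3' = - A2"
    using A by (auto simp: algebra_simps eq_neg_iff_add_eq_0)
  have s: "d \<bullet> (A2 *v r) = r \<bullet> (A2 *v d)" "d \<bullet> (A2 *v r') = r' \<bullet> (A2 *v d)"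
    "d' \<bullet> (A2' *v r) = r \<bullet> (A2' *v d')" "d' \<bullet> (A2' *v r') = r' \<bullet> (A2' *v d')"
    using inner_sym_mat[OF sym(1), of d] inner_sym_mat[OF sym(2), of d'] by (simp_all add: inner_commute)
  note neg = uminus_matrix_vector_mult matrix_vector_mult_uminus
  show ?thesis
    unfolding eqs neg j f
    by (simp add: matrix_vector_mult_diff_rdistrib neg inner_add_left inner_add_right inner_diff_left inner_diff_right
        matrix_vector_right_distrib matrix_vector_mult_diff_distrib s algebra_simps)
qed

text \<open>In the application \<open>A\<close> and \<open>B\<close> are the \<open>T1\<close>
  matrices of two facets of an element and \<open>C\<close> is the \<open>T5\<close> matrix that
  couples them.\<close>

lemma weighted_young:
  fixes A :: "real ^ 'f::finite ^ 'f"
  assumes "sym_mat B" "pd B" "C' = transpose C"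
    and "psd (A - 64 *\<^sub>R (C ** matrix_inv B ** C'))"
  shows "- (x \<bullet> (C *v y)) \<le> (x \<bullet> (A *v x) + y \<bullet> (B *v y)) / 16"
proof -
  note cancel = matrix_inv_cancel[OF pd_imp_invertible[OF assms(2)]]
  define z where "z = C' *v x"
  have z: "x \<bullet> (C *v w) = z \<bullet> w" for w
    using inner_transpose[of w C x] by (simp only: z_def assms(3)) (metis inner_commute)
  \<comment> \<open>The factor 8 gives the cross term the coefficient 16, the final denominator, and
    the last term the coefficient 64, which matches the hypothesis on \<open>A\<close>.\<close>
  let ?v = "y + 8 *\<^sub>R (matrix_inv B *v z)"
  have "0 \<le> ?v \<bullet> (B *v ?v)"
    using assms(2) unfolding pd_def by (metis inner_zero_left less_eq_real_def)
  also have "\<dots> = y \<bullet> (B *v y) + 16 * (z \<bullet> y) + 64 * (z \<bullet> (matrix_inv B *v z))"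
    using inner_sym_mat[OF assms(1), of "matrix_inv B *v z" y]
    by (simp add: matrix_vector_right_distrib matrix_vector_mult_scaleR inner_add_left inner_add_right cancel
        inner_commute)
  finally have 1: "- 16 * (z \<bullet> y) \<le> y \<bullet> (B *v y) + 64 * (z \<bullet> (matrix_inv B *v z))"
    by simp
  have "0 \<le> x \<bullet> (A *v x) - 64 * (x \<bullet> (C *v (matrix_inv B *v z)))"
    using assms(4)[unfolded psd_def, rule_format, of x]
    by (simp add: z_def matrix_vector_mul_assoc matrix_mul_assoc matrix_vector_mult_diff_rdistrib inner_diff_right
        scaleR_matrix_vector_assoc[symmetric])
  then show ?thesis
    using 1 by (simp add: z)
qed

text \<open>An index has at most two partners, so each \<open>q a\<close> occurs at most twice as
  first and twice as second member of a pair: four times 1/16.\<close>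

lemma sum_pairs_bound:
  fixes q :: "'g \<Rightarrow> real"
  assumes "finite I" "card I \<le> 3" "\<And>a. a \<in> I \<Longrightarrow> 0 \<le> q a"
    and "\<And>a b. a \<in> I \<Longrightarrow> b \<in> I \<Longrightarrow> a \<noteq> b \<Longrightarrow> x a b \<le> (q a + q b) / 16"
  shows "(\<Sum>a\<in>I. \<Sum>b\<in>I - {a}. x a b) \<le> (\<Sum>a\<in>I. q a) / 4"
proof -
  have "(\<Sum>a\<in>I. \<Sum>b\<in>I - {a}. x a b) \<le> (\<Sum>a\<in>I. \<Sum>b\<in>I - {a}. (q a + q b) / 16)"
    by (intro sum_mono assms(4)) auto
  also have "\<dots> = (\<Sum>a\<in>I. \<Sum>b\<in>I - {a}. q a) / 16 + (\<Sum>a\<in>I. \<Sum>b\<in>I - {a}. q b) / 16"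
    by (simp add: sum.distrib sum_divide_distrib add_divide_distrib)
  also have "(\<Sum>a\<in>I. \<Sum>b\<in>I - {a}. q b) = (\<Sum>a\<in>I. \<Sum>b\<in>I - {a}. q a)"
  proof -
    \<comment> \<open>Being distinct is a symmetric relation, so first and second members can be
      exchanged.\<close>
    have "(\<Sum>a\<in>I. \<Sum>b | b \<in> I \<and> a \<noteq> b. q b) = (\<Sum>b\<in>I. \<Sum>a | a \<in> I \<and> a \<noteq> b. q b)"
      by (rule sum.swap_restrict) (use assms in auto)
    moreover have "{b \<in> I. a \<noteq> b} = I - {a}" "{b \<in> I. b \<noteq> a} = I - {a}" for a
      by auto
    ultimately show ?thesis
      by simp
  qed
  also have "(\<Sum>a\<in>I. \<Sum>b\<in>I - {a}. q a) \<le> (\<Sum>a\<in>I. 2 * q a)"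
  proof (rule sum_mono)
    fix a assume "a \<in> I"
    then have "card (I - {a}) \<le> 2"
      using assms(1,2) by simp
    then show "(\<Sum>b\<in>I - {a}. q a) \<le> 2 * q a"
      using assms(3)[OF \<open>a \<in> I\<close>] by (simp add: mult_right_mono)
  qed
  finally show ?thesis
    by (simp add: sum_distrib_left[symmetric])
qed

section \<open>Time derivative of the energy\<close>

text \<open>The product rule yields two terms per element, which coincide by symmetry of the norm
  matrix; this is the factor 2.\<close>

lemma energy_has_derivative:
  assumes "semidiscrete_solution P M S T u" "0 \<le> t"
    and "\<And>k. k \<in> elems M \<Longrightarrow> sym_mat (Hm S k)"
  shows "((\<lambda>s. energy M S (u s)) has_real_derivative
    2 * (\<Sum>k\<in>elems M. u t k \<bullet> (Hm S k *v semidiscrete_rhs P M S T t (u t) k))) (at t within {0..})"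
proof -
  have "((\<lambda>s. u s k \<bullet> (Hm S k *v u s k)) has_vector_derivative
      2 * (u t k \<bullet> (Hm S k *v semidiscrete_rhs P M S T t (u t) k))) (at t within {0..})"
    if k: "k \<in> elems M" for k
  proof -
    let ?f = "semidiscrete_rhs P M S T t (u t) k"
    have f: "((\<lambda>s. u s k) has_vector_derivative ?f) (at t within {0..})"
      using assms(1,2) k unfolding semidiscrete_solution_def by blast
    have "((\<lambda>s. u s k \<bullet> (Hm S k *v u s k)) has_vector_derivative
        u t k \<bullet> (Hm S k *v ?f) + ?f \<bullet> (Hm S k *v u t k)) (at t within {0..})"
      by (intro bounded_bilinear.has_vector_derivative[OF bounded_bilinear_inner] f
          bounded_linear.has_vector_derivative[OF matrix_vector_mul_bounded_linear])
    moreover have "?f \<bullet> (Hm S k *v u t k) = u t k \<bullet> (Hm S k *v ?f)"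
      using inner_sym_mat[OF assms(3)[OF k], of "u t k" ?f] by (simp add: inner_commute)
    ultimately show ?thesis
      by simp
  qed
  then show ?thesis
    unfolding energy_def has_real_derivative_iff_has_vector_derivative sum_distrib_left
    by (rule has_vector_derivative_sum)
qed

section \<open>Facet classes, and facet quantities seen from both sides\<close>

text \<open>A facet lies on one or two elements, so it is a boundary or an interior facet, and the
  boundary facets split into Dirichlet and Neumann ones. Facet sums are divided accordingly in the
  estimate.\<close>

lemma conforming_meshD:
  assumes "conforming_mesh P M"
  shows "finite (elems M)"
    and "k \<in> elems M \<Longrightarrow> finite (facets M k)"
    and "k \<in> elems M \<Longrightarrow> card (int_facets M k) \<le> 3"
    and "k \<in> elems M \<Longrightarrow> facets M k = int_facets M k \<union> (dir_facets P M k \<union> neu_facets P M k)"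
    and "k \<in> elems M \<Longrightarrow> int_facets M k \<inter> (dir_facets P M k \<union> neu_facets P M k) = {}"
    and "k \<in> elems M \<Longrightarrow> dir_facets P M k \<inter> neu_facets P M k = {}"
proof -
  show "finite (elems M)"
    using assms unfolding conforming_mesh_def by (elim conjE)
  assume k: "k \<in> elems M"
  have "\<forall>k\<in>elems M. card (facets M k) = 3 \<and>
      curved_triangle (elem_dom M k) ((\<lambda>\<gamma>. path_image (curve M \<gamma>)) ` facets M k)"
    using assms unfolding conforming_mesh_def by (elim conjE)
  then have 3: "card (facets M k) = 3"
    using k by blast
  then show fin: "finite (facets M k)"
    \<comment> \<open>An infinite set has \<open>card\<close> 0 by convention, so cardinality 3
      forces finiteness.\<close>
    by (metis card.infinite zero_neq_numeral)
  then show "card (int_facets M k) \<le> 3"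
    unfolding 3[symmetric] by (intro card_mono) (auto simp: int_facets_def)
  have "\<forall>k\<in>elems M. bdry_facets M k = dir_facets P M k \<union> neu_facets P M k \<and>
      dir_facets P M k \<inter> neu_facets P M k = {}"
    using assms unfolding conforming_mesh_def by (elim conjE)
  then have bdry: "bdry_facets M k = dir_facets P M k \<union> neu_facets P M k"
    and "dir_facets P M k \<inter> neu_facets P M k = {}"
    using k by blast+
  then show "dir_facets P M k \<inter> neu_facets P M k = {}"
    by blast
  have "\<forall>\<gamma>\<in>all_facets M. smooth_arc (curve M \<gamma>) \<and> card (elems_at M \<gamma>) \<in> {1, 2}"
    using assms unfolding conforming_mesh_def by (elim conjE)
  then have "card (elems_at M \<gamma>) = 1 \<or> card (elems_at M \<gamma>) = 2" if "\<gamma> \<in> facets M k" for \<gamma>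
    using that k by (auto simp: all_facets_def)
  then show "facets M k = int_facets M k \<union> (dir_facets P M k \<union> neu_facets P M k)"
    "int_facets M k \<inter> (dir_facets P M k \<union> neu_facets P M k) = {}"
    unfolding bdry[symmetric] by (auto simp: int_facets_def bdry_facets_def)
qed

lemma jump_neighbour:
  assumes "k \<in> elems M" "\<gamma> \<in> int_facets M k"
  shows "jump M S u \<gamma> (neighbour M \<gamma> k) = - jump M S u \<gamma> k"
  using assms by (simp add: jump_def neighbour_int_facet)

lemma flux_sum_neighbour:
  assumes "k \<in> elems M" "\<gamma> \<in> int_facets M k"
  shows "flux_sum P M S u \<gamma> (neighbour M \<gamma> k) = flux_sum P M S u \<gamma> k"
  using assms by (simp add: flux_sum_def neighbour_int_facet add.commute)

section \<open>SAT terms tested with the solution\<close>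

text \<open>The \<open>T5\<close> and \<open>T6\<close> part is kept apart: it contains jumps on
  facets of neighbouring elements and becomes tractable only after summation over all
  elements.\<close>

definition extended_coupling ::
    "('k, 'g) mesh \<Rightarrow> ('k, 'g, 'p::finite, 'f::finite) sbp_data \<Rightarrow> ('k, 'g, 'f) sat_coeffs \<Rightarrow>
     ('k \<Rightarrow> real ^ 'p) \<Rightarrow> 'k \<Rightarrow> real" where
  "extended_coupling M S T u k = (\<Sum>\<gamma>\<in>int_facets M k.
     (\<Sum>\<epsilon>\<in>int_facets M k - {\<gamma>}. (Rm S \<gamma> k *v u k) \<bullet> (T5 T \<gamma> \<epsilon> k *v jump M S u \<epsilon> k)) +
     (\<Sum>\<delta>\<in>int_facets M (neighbour M \<gamma> k) - {\<gamma>}.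
       (Rm S \<gamma> k *v u k) \<bullet> (T6 T \<gamma> \<delta> (neighbour M \<gamma> k) *v jump M S u \<delta> (neighbour M \<gamma> k))))"

lemma inner_sat_int:
  "u k \<bullet> sat_int P M S T u k =
    (\<Sum>\<gamma>\<in>int_facets M k.
      (Rm S \<gamma> k *v u k) \<bullet> (T1 T \<gamma> k *v jump M S u \<gamma> k + T3 T \<gamma> k *v flux_sum P M S u \<gamma> k) +
      (Df P S \<gamma> k *v u k) \<bullet> (T2 T \<gamma> k *v jump M S u \<gamma> k + T4 T \<gamma> k *v flux_sum P M S u \<gamma> k)) +
    extended_coupling M S T u k"
  by (simp only: sat_int_def extended_coupling_def Let_def inner_add_right inner_sum_right
      matrix_vector_mul_assoc[symmetric] block_mat_mul inner_hcat_transpose inner_transpose)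

lemma inner_sat_bdry:
  assumes "homogeneous P"
  shows "u k \<bullet> sat_bdry P M S T t u k =
    (\<Sum>\<gamma>\<in>dir_facets P M k.
      (Rm S \<gamma> k *v u k) \<bullet> (TD T \<gamma> *v (Rm S \<gamma> k *v u k)) -
      (Df P S \<gamma> k *v u k) \<bullet> (Bm S \<gamma> *v (Rm S \<gamma> k *v u k))) +
    (\<Sum>\<gamma>\<in>neu_facets P M k. (Rm S \<gamma> k *v u k) \<bullet> (Bm S \<gamma> *v (Df P S \<gamma> k *v u k)))"
proof -
  have data: "w - (\<chi> j. dir P t (fnode S \<gamma> j)) = w" "w - (\<chi> j. neu P t (fnode S \<gamma> j)) = w" for w \<gamma>
    using assms by (simp_all add: homogeneous_def vec_eq_iff)
  show ?thesis
    unfolding sat_bdry_def data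
    by (simp only: inner_add_right inner_sum_right matrix_vector_mul_assoc[symmetric]
        vcat_mul inner_hcat_transpose inner_transpose uminus_matrix_vector_mult inner_minus_right diff_conv_add_uminus)
qed

text \<open>Crossing the facet moves each \<open>T6\<close> term to the element whose jumps it
  contains. There it meets the \<open>T5\<close> term of the same pair of facets, and
  \<open>T5 = - T6\<close> combines the facet values from the two sides into a jump.\<close>

lemma sum_extended_coupling:
  assumes mesh: "conforming_mesh P M" and adjoint: "adjoint_consistent M S T"
  shows "(\<Sum>k\<in>elems M. extended_coupling M S T u k) =
    (\<Sum>k\<in>elems M. \<Sum>\<gamma>\<in>int_facets M k. \<Sum>\<epsilon>\<in>int_facets M k - {\<gamma>}.
      jump M S u \<gamma> k \<bullet> (T5 T \<gamma> \<epsilon> k *v jump M S u \<epsilon> k))"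
proof -
  define f where "f \<gamma> k = (\<Sum>\<delta>\<in>int_facets M k - {\<gamma>}.
    (Rm S \<gamma> (neighbour M \<gamma> k) *v u (neighbour M \<gamma> k)) \<bullet> (T6 T \<gamma> \<delta> k *v jump M S u \<delta> k))" for \<gamma> k
  have "(\<Sum>k\<in>elems M. extended_coupling M S T u k) =
      (\<Sum>k\<in>elems M. \<Sum>\<gamma>\<in>int_facets M k.
        \<Sum>\<epsilon>\<in>int_facets M k - {\<gamma>}. (Rm S \<gamma> k *v u k) \<bullet> (T5 T \<gamma> \<epsilon> k *v jump M S u \<epsilon> k)) +
      (\<Sum>k\<in>elems M. \<Sum>\<gamma>\<in>int_facets M k. f \<gamma> (neighbour M \<gamma> k))"
    by (simp add: extended_coupling_def f_def sum.distrib neighbour_int_facet cong: sum.cong)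
  also have "(\<Sum>k\<in>elems M. \<Sum>\<gamma>\<in>int_facets M k. f \<gamma> (neighbour M \<gamma> k)) =
      (\<Sum>k\<in>elems M. \<Sum>\<gamma>\<in>int_facets M k. f \<gamma> k)"
    by (intro sum_int_facets_swap conforming_meshD[OF mesh])
  also have "(\<Sum>k\<in>elems M. \<Sum>\<gamma>\<in>int_facets M k.
        \<Sum>\<epsilon>\<in>int_facets M k - {\<gamma>}. (Rm S \<gamma> k *v u k) \<bullet> (T5 T \<gamma> \<epsilon> k *v jump M S u \<epsilon> k)) +
      (\<Sum>k\<in>elems M. \<Sum>\<gamma>\<in>int_facets M k. f \<gamma> k) =
    (\<Sum>k\<in>elems M. \<Sum>\<gamma>\<in>int_facets M k. \<Sum>\<epsilon>\<in>int_facets M k - {\<gamma>}.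
      jump M S u \<gamma> k \<bullet> (T5 T \<gamma> \<epsilon> k *v jump M S u \<epsilon> k))"
    unfolding f_def sum.distrib[symmetric]
  proof (intro sum.cong refl)
    fix k \<gamma> \<delta>
    assume "k \<in> elems M" "\<gamma> \<in> int_facets M k" "\<delta> \<in> int_facets M k - {\<gamma>}"
    moreover have "\<forall>k\<in>elems M. \<forall>a\<in>int_facets M k. \<forall>b\<in>int_facets M k. a \<noteq> b \<longrightarrow> T5 T a b k = - T6 T a b k"
      using adjoint unfolding adjoint_consistent_def by (elim conjE)
    ultimately have "T5 T \<gamma> \<delta> k = - T6 T \<gamma> \<delta> k"
      by (metis DiffE insertI1)
    then show "(Rm S \<gamma> k *v u k) \<bullet> (T5 T \<gamma> \<delta> k *v jump M S u \<delta> k) +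
        (Rm S \<gamma> (neighbour M \<gamma> k) *v u (neighbour M \<gamma> k)) \<bullet> (T6 T \<gamma> \<delta> k *v jump M S u \<delta> k) =
      jump M S u \<gamma> k \<bullet> (T5 T \<gamma> \<delta> k *v jump M S u \<delta> k)"
      by (simp add: uminus_matrix_vector_mult jump_def[of M S u \<gamma>] inner_diff_left)
  qed
  finally show ?thesis .
qed

section \<open>Dissipation of the energy for homogeneous data\<close>

theorem theorem8:
  fixes P :: diffusion_data
    and M :: "('k, 'g) mesh"
    and S :: "('k, 'g, 'p::finite, 'f::finite) sbp_data"
    and T :: "('k, 'g, 'f) sat_coeffs"
  assumes problem: "diffusion_problem P"
    and mesh: "conforming_mesh P M"
    and operators: "sbp_operators P M S"
    and adjoint: "adjoint_consistent M S T"
    and homogeneous: "homogeneous P"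
    and sym: "\<And>k a. k \<in> elems M \<Longrightarrow> a \<in> int_facets M k \<Longrightarrow>
        sym_mat (T1 T a k) \<and> sym_mat (T2 T a k) \<and> sym_mat (T3 T a k) \<and> sym_mat (T4 T a k)"
    and sym_D: "\<And>k \<gamma>. k \<in> elems M \<Longrightarrow> \<gamma> \<in> dir_facets P M k \<Longrightarrow> sym_mat (TD T \<gamma>)"
    and sym_56: "\<And>k a b. k \<in> elems M \<Longrightarrow> a \<in> int_facets M k \<Longrightarrow> b \<in> int_facets M k \<Longrightarrow> a \<noteq> b \<Longrightarrow>
        T5 T a b k = transpose (T5 T b a k) \<and> T6 T a b k = transpose (T6 T b a k)"
    and T3_T2: "\<And>k \<gamma>. k \<in> elems M \<Longrightarrow> \<gamma> \<in> int_facets M k \<Longrightarrow> T3 T \<gamma> k - T2 T \<gamma> k = Bm S \<gamma>"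
    and T1_pd: "\<And>k a. k \<in> elems M \<Longrightarrow> a \<in> int_facets M k \<Longrightarrow> pd (T1 T a k)"
    and cond_T1: "\<And>k v \<gamma>. k \<in> elems M \<Longrightarrow> \<gamma> \<in> int_facets M k \<Longrightarrow> v = neighbour M \<gamma> k \<Longrightarrow>
        psd (T1 T \<gamma> k - (2 / zeta M T) *\<^sub>R
          ((1 / fwt S \<gamma> k) *\<^sub>R (T2 T \<gamma> k ** Upsilon P S \<gamma> \<gamma> k ** T2 T \<gamma> k) +
           (1 / fwt S \<gamma> v) *\<^sub>R (T2 T \<gamma> v ** Upsilon P S \<gamma> \<gamma> v ** T2 T \<gamma> v)))"
    and cond_T5: "\<And>k a b. k \<in> elems M \<Longrightarrow> a \<in> int_facets M k \<Longrightarrow> b \<in> int_facets M k \<Longrightarrow> a \<noteq> b \<Longrightarrow>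
        psd (T1 T a k - 64 *\<^sub>R (T5 T a b k ** matrix_inv (T1 T b k) ** T5 T b a k))"
    and cond_TD: "\<And>k \<gamma>. k \<in> elems M \<Longrightarrow> \<gamma> \<in> dir_facets P M k \<Longrightarrow>
        psd (TD T \<gamma> - (1 / fwt S \<gamma> k) *\<^sub>R (Bm S \<gamma> ** Upsilon P S \<gamma> \<gamma> k ** Bm S \<gamma>))"
    and cond_T4: "\<And>k \<gamma>. k \<in> elems M \<Longrightarrow> \<gamma> \<in> int_facets M k \<Longrightarrow> psd (T4 T \<gamma> k)"
  shows "energy_stable P M S T"
proof -
  note mesh_facts = conforming_meshD[OF mesh]
  note elem = problem mesh operators
  define z where "z = zeta M T"
  have z: "0 < z"
    by (simp add: z_def zeta_def)
  \<comment> \<open>The bound is purely algebraic, so it is shown for every grid function and not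
    only along solutions.\<close>
  have dissipation: "(\<Sum>k\<in>elems M. u k \<bullet> (Hm S k *v semidiscrete_rhs P M S T t u k)) \<le> 0" for t u
  proof -
    define r where "r \<gamma> k = Rm S \<gamma> k *v u k" for \<gamma> k
    define d where "d \<gamma> k = Df P S \<gamma> k *v u k" for \<gamma> k
    define j where "j \<gamma> k = jump M S u \<gamma> k" for \<gamma> k
    define f where "f \<gamma> k = flux_sum P M S u \<gamma> k" for \<gamma> k
    define a where "a \<gamma> k = fwt S \<gamma> k" for \<gamma> k
    define G where "G k = grad_norm P S k (u k)" for k
    define q where "q \<gamma> k = j \<gamma> k \<bullet> (T1 T \<gamma> k *v j \<gamma> k)" for \<gamma> k
    \<comment> \<open>The price of completing the square with the vector
      \<open>T2 j\<close>.\<close>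
    define w where "w \<gamma> k = (1 / a \<gamma> k) *
      ((T2 T \<gamma> k *v j \<gamma> k) \<bullet> (Upsilon P S \<gamma> \<gamma> k *v (T2 T \<gamma> k *v j \<gamma> k)))" for \<gamma> k
    define s where "s \<gamma> k = r \<gamma> k \<bullet> (T1 T \<gamma> k *v j \<gamma> k + T3 T \<gamma> k *v f \<gamma> k) +
      d \<gamma> k \<bullet> (T2 T \<gamma> k *v j \<gamma> k + T4 T \<gamma> k *v f \<gamma> k)" for \<gamma> k
    \<comment> \<open>What remains of an interior facet after its share of the volume term has been
      spent on that square.\<close>
    define g where "g \<gamma> k = w \<gamma> k + 2 * (d \<gamma> k \<bullet> (T2 T \<gamma> k *v j \<gamma> k)) +
      r \<gamma> k \<bullet> (Bm S \<gamma> *v d \<gamma> k) - s \<gamma> k" for \<gamma> k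
    define X where "X k = extended_coupling M S T u k" for k

    have a_pos: "0 < a \<gamma> k" if "k \<in> elems M" "\<gamma> \<in> facets M k" for \<gamma> k
      using operators that unfolding sbp_operators_def a_def by blast
    have G_nonneg: "0 \<le> G k" if "k \<in> elems M" for k
      unfolding G_def by (rule grad_norm_nonneg[OF elem that])
    have square: "0 \<le> a \<gamma> k * G k + 2 * (d \<gamma> k \<bullet> y) + (1 / a \<gamma> k) * (y \<bullet> (Upsilon P S \<gamma> \<gamma> k *v y))"
      if "k \<in> elems M" "\<gamma> \<in> facets M k" for \<gamma> k y
      unfolding G_def d_def using facet_square_nonneg[OF elem that(1) a_pos[OF that]] .

    have interior: "- a \<gamma> k * G k + r \<gamma> k \<bullet> (Bm S \<gamma> *v d \<gamma> k) - s \<gamma> k \<le> g \<gamma> k"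
      if "k \<in> elems M" "\<gamma> \<in> int_facets M k" for \<gamma> k
      using square[OF that(1), of \<gamma> "T2 T \<gamma> k *v j \<gamma> k"] that(2)
      by (simp add: g_def w_def int_facets_def)

    have dirichlet: "- a \<gamma> k * G k + r \<gamma> k \<bullet> (Bm S \<gamma> *v d \<gamma> k) -
        (r \<gamma> k \<bullet> (TD T \<gamma> *v r \<gamma> k) - d \<gamma> k \<bullet> (Bm S \<gamma> *v r \<gamma> k)) \<le> 0"
      if k: "k \<in> elems M" and \<gamma>: "\<gamma> \<in> dir_facets P M k" for \<gamma> k
    proof -
      have facet: "\<gamma> \<in> facets M k"
        using \<gamma> by (simp add: dir_facets_def bdry_facets_def)
      then have "\<gamma> \<in> all_facets M"
        using k by (auto simp: all_facets_def)
      then obtain b where b: "Bm S \<gamma> = diag_mat b"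
        using operators unfolding sbp_operators_def by blast
      have B: "x \<bullet> (Bm S \<gamma> *v y) = (Bm S \<gamma> *v x) \<bullet> y" for x y
        unfolding b by (rule inner_sym_mat[OF sym_mat_diag_mat])
      have "0 \<le> r \<gamma> k \<bullet> (TD T \<gamma> *v r \<gamma> k) -
          (1 / a \<gamma> k) * ((Bm S \<gamma> *v r \<gamma> k) \<bullet> (Upsilon P S \<gamma> \<gamma> k *v (Bm S \<gamma> *v r \<gamma> k)))"
        using cond_TD[OF k \<gamma>, unfolded psd_def, rule_format, of "r \<gamma> k"]
        by (simp only: a_def B[symmetric] matrix_vector_mult_diff_rdistrib inner_diff_right inner_scaleR_right
            scaleR_matrix_vector_assoc[symmetric] matrix_vector_mul_assoc matrix_mul_assoc)
      \<comment> \<open>The pairing of the flux with \<open>B r\<close> enters twice, once from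
        summation by parts and once from the Dirichlet SAT, so the square is completed with
        \<open>- B r\<close>.\<close>
      moreover have "0 \<le> a \<gamma> k * G k - 2 * (d \<gamma> k \<bullet> (Bm S \<gamma> *v r \<gamma> k)) +
          (1 / a \<gamma> k) * ((Bm S \<gamma> *v r \<gamma> k) \<bullet> (Upsilon P S \<gamma> \<gamma> k *v (Bm S \<gamma> *v r \<gamma> k)))"
        using square[OF k facet, of "- (Bm S \<gamma> *v r \<gamma> k)"] by (simp add: matrix_vector_mult_uminus)
      moreover have "r \<gamma> k \<bullet> (Bm S \<gamma> *v d \<gamma> k) = d \<gamma> k \<bullet> (Bm S \<gamma> *v r \<gamma> k)"
        unfolding B[of "r \<gamma> k" "d \<gamma> k"] by (rule inner_commute)
      ultimately show ?thesis
        by simp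
    qed

    have element: "u k \<bullet> (Hm S k *v semidiscrete_rhs P M S T t u k) \<le> (\<Sum>\<gamma>\<in>int_facets M k. g \<gamma> k) - X k"
      if k: "k \<in> elems M" for k
    proof -
      let ?I = "int_facets M k" and ?D = "dir_facets P M k" and ?N = "neu_facets P M k"
      let ?v = "\<lambda>\<gamma>. - a \<gamma> k * G k + r \<gamma> k \<bullet> (Bm S \<gamma> *v d \<gamma> k)"
      have src: "(\<chi> i. src P t (vnode S k i)) = 0"
        using homogeneous by (simp add: homogeneous_def vec_eq_iff)
      have "(\<Sum>\<gamma>\<in>facets M k. a \<gamma> k) = 1"
        using operators k unfolding sbp_operators_def a_def by blast
      \<comment> \<open>As the weights sum to 1, the volume term is distributed over all facets,
        boundary ones included.\<close>
      then have "(\<Sum>\<gamma>\<in>facets M k. ?v \<gamma>) = - G k + (\<Sum>\<gamma>\<in>facets M k. r \<gamma> k \<bullet> (Bm S \<gamma> *v d \<gamma> k))"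
        by (simp add: sum_subtractf sum_distrib_right[symmetric])
      then have "u k \<bullet> (Hm S k *v (D2 P S k *v u k)) = (\<Sum>\<gamma>\<in>facets M k. ?v \<gamma>)"
        by (simp add: volume_term[OF elem k] G_def r_def d_def)
      also have "\<dots> = (\<Sum>\<gamma>\<in>?I. ?v \<gamma>) + ((\<Sum>\<gamma>\<in>?D. ?v \<gamma>) + (\<Sum>\<gamma>\<in>?N. ?v \<gamma>))"
      proof -
        have "finite ?I" "finite ?D" "finite ?N"
          using mesh_facts(2)[OF k] mesh_facts(4)[OF k] by simp_all
        then show ?thesis
          unfolding mesh_facts(4)[OF k]
          by (simp only: sum.union_disjoint mesh_facts(5)[OF k] mesh_facts(6)[OF k] finite_UnI)
      qed
      finally have "u k \<bullet> (Hm S k *v semidiscrete_rhs P M S T t u k) =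
          (\<Sum>\<gamma>\<in>?I. ?v \<gamma> - s \<gamma> k) - X k +
          (\<Sum>\<gamma>\<in>?D. ?v \<gamma> - (r \<gamma> k \<bullet> (TD T \<gamma> *v r \<gamma> k) - d \<gamma> k \<bullet> (Bm S \<gamma> *v r \<gamma> k))) +
          (\<Sum>\<gamma>\<in>?N. ?v \<gamma> - r \<gamma> k \<bullet> (Bm S \<gamma> *v d \<gamma> k))"
        unfolding semidiscrete_rhs_def src
        by (simp only: matrix_vector_mult_diff_distrib inner_diff_right add_0_right
            matrix_inv_cancel[OF pd_imp_invertible[OF sbp_elementD(2)[OF elem k]]]
            inner_sat_int inner_sat_bdry[OF homogeneous] sum_subtractf)
          (simp add: r_def d_def j_def f_def s_def X_def)
      moreover have "(\<Sum>\<gamma>\<in>?I. ?v \<gamma> - s \<gamma> k) \<le> (\<Sum>\<gamma>\<in>?I. g \<gamma> k)"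
        by (intro sum_mono interior k)
      moreover have "(\<Sum>\<gamma>\<in>?D. ?v \<gamma> - (r \<gamma> k \<bullet> (TD T \<gamma> *v r \<gamma> k) - d \<gamma> k \<bullet> (Bm S \<gamma> *v r \<gamma> k))) \<le> 0"
        by (intro sum_nonpos dirichlet k)
      \<comment> \<open>The Neumann SAT cancels the facet term of summation by parts exactly, and
        only the nonpositive volume share is left.\<close>
      moreover have "(\<Sum>\<gamma>\<in>?N. ?v \<gamma> - r \<gamma> k \<bullet> (Bm S \<gamma> *v d \<gamma> k)) \<le> 0"
      proof (intro sum_nonpos)
        fix \<gamma> assume "\<gamma> \<in> ?N"
        then have "0 \<le> a \<gamma> k * G k"
          using a_pos[OF k, of \<gamma>] G_nonneg[OF k] by (simp add: neu_facets_def bdry_facets_def)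
        then show "?v \<gamma> - r \<gamma> k \<bullet> (Bm S \<gamma> *v d \<gamma> k) \<le> 0"
          by simp
      qed
      ultimately show ?thesis
        by linarith
    qed

    \<comment> \<open>Together the two sides leave
      \<open>w \<gamma> k + w \<gamma> v - q \<gamma> k\<close> up to a \<open>T4\<close> term of
      good sign. The condition on \<open>T1\<close> bounds the two prices by \<open>z / 2\<close>
      times \<open>q \<gamma> k\<close>, so the factor is \<open>(z - 2) / 2\<close>, split evenly
      because \<open>q\<close> agrees on both sides.\<close>
    have pair: "g \<gamma> k + g \<gamma> (neighbour M \<gamma> k) \<le>
        ((z - 2) / 4) * q \<gamma> k + ((z - 2) / 4) * q \<gamma> (neighbour M \<gamma> k)"
      if k: "k \<in> elems M" and \<gamma>: "\<gamma> \<in> int_facets M k" for \<gamma> k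
    proof -
      define v where "v = neighbour M \<gamma> k"
      note nb = neighbour_int_facet[OF k \<gamma>, folded v_def]
      have adj: "T1 T \<gamma> v = T1 T \<gamma> k" "T2 T \<gamma> k + T2 T \<gamma> v = - Bm S \<gamma>"
        "T3 T \<gamma> k + T3 T \<gamma> v = Bm S \<gamma>" "T4 T \<gamma> v = T4 T \<gamma> k"
        using adjoint k \<gamma> unfolding adjoint_consistent_def Let_def v_def by metis+
      have sym2: "sym_mat (T2 T \<gamma> k)" "sym_mat (T2 T \<gamma> v)"
        using sym k \<gamma> nb by blast+
      have jv: "j \<gamma> v = - j \<gamma> k" and fv: "f \<gamma> v = f \<gamma> k"
        by (simp_all add: j_def f_def v_def jump_neighbour flux_sum_neighbour k \<gamma>)
      have jr: "j \<gamma> k = r \<gamma> k - r \<gamma> v" and fd: "f \<gamma> k = d \<gamma> k + d \<gamma> v"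
        by (simp_all add: j_def f_def r_def d_def v_def jump_def flux_sum_def)
      have "g \<gamma> k + g \<gamma> v = w \<gamma> k + w \<gamma> v - q \<gamma> k - f \<gamma> k \<bullet> (T4 T \<gamma> k *v f \<gamma> k)"
        using facet_pair_identity[OF sym2 adj(2,3) T3_T2[OF k \<gamma>] jr fd, of "T1 T \<gamma> k" "T4 T \<gamma> k"]
        unfolding g_def s_def q_def adj(1) adj(4) jv fv by linarith
      moreover have "0 \<le> f \<gamma> k \<bullet> (T4 T \<gamma> k *v f \<gamma> k)"
        using cond_T4[OF k \<gamma>] by (simp add: psd_def)
      moreover have "w \<gamma> k + w \<gamma> v \<le> (z / 2) * q \<gamma> k"
      proof -
        \<comment> \<open>\<open>w\<close> is quadratic in the jump, so the change of sign across
          the facet has no effect.\<close>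
        have "w \<gamma> v = (1 / a \<gamma> v) * ((T2 T \<gamma> v *v j \<gamma> k) \<bullet> (Upsilon P S \<gamma> \<gamma> v *v (T2 T \<gamma> v *v j \<gamma> k)))"
          by (simp add: w_def jv matrix_vector_mult_uminus)
        moreover have "0 \<le> q \<gamma> k - (2 / z) *
            ((1 / a \<gamma> k) * ((T2 T \<gamma> k *v j \<gamma> k) \<bullet> (Upsilon P S \<gamma> \<gamma> k *v (T2 T \<gamma> k *v j \<gamma> k))) +
             (1 / a \<gamma> v) * ((T2 T \<gamma> v *v j \<gamma> k) \<bullet> (Upsilon P S \<gamma> \<gamma> v *v (T2 T \<gamma> v *v j \<gamma> k))))"
          using cond_T1[OF k \<gamma> v_def, unfolded psd_def, rule_format, of "j \<gamma> k"]
          by (simp only: q_def a_def z_def inner_sym_mat[OF sym2(1), symmetric] inner_sym_mat[OF sym2(2), symmetric]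
              matrix_vector_mult_diff_rdistrib matrix_vector_mult_add_rdistrib inner_diff_right inner_add_right
              inner_scaleR_right scaleR_matrix_vector_assoc[symmetric] matrix_vector_mul_assoc matrix_mul_assoc)
        ultimately have "0 \<le> q \<gamma> k - (2 / z) * (w \<gamma> k + w \<gamma> v)"
          by (simp only: w_def[of \<gamma> k])
        then show ?thesis
          using z by (simp add: field_simps)
      qed
      moreover have "q \<gamma> v = q \<gamma> k"
        by (simp add: q_def jv adj(1) matrix_vector_mult_uminus)
      ultimately show ?thesis
        unfolding v_def[symmetric] by (simp add: field_simps)
    qed

    \<comment> \<open>The factor is the negative of the one in \<open>pair\<close>, so the two
      bounds cancel when added. It is 0 for compact stencils, where there is no coupling, and 1/4
      otherwise, the constant of \<open>sum_pairs_bound\<close>.\<close>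
    have coupling: "- (\<Sum>k\<in>elems M. X k) \<le> ((2 - z) / 4) * (\<Sum>k\<in>elems M. \<Sum>\<gamma>\<in>int_facets M k. q \<gamma> k)"
    proof -
      have X: "- (\<Sum>k\<in>elems M. X k) = (\<Sum>k\<in>elems M. \<Sum>\<gamma>\<in>int_facets M k. \<Sum>\<epsilon>\<in>int_facets M k - {\<gamma>}.
          - (j \<gamma> k \<bullet> (T5 T \<gamma> \<epsilon> k *v j \<epsilon> k)))"
        by (simp add: X_def sum_extended_coupling[OF mesh adjoint] sum_negf j_def)
      show ?thesis
      proof (cases "compact_stencil M T")
        case True
        then have "T5 T \<gamma> \<epsilon> k = 0"
          if "k \<in> elems M" "\<gamma> \<in> int_facets M k" "\<epsilon> \<in> int_facets M k - {\<gamma>}" for k \<gamma> \<epsilon>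
          using that unfolding compact_stencil_def by (metis DiffE insertI1)
        then have "- (\<Sum>k\<in>elems M. X k) = 0"
          unfolding X by (intro sum.neutral ballI) simp
        moreover have "z = 2"
          using True by (simp add: z_def zeta_def)
        ultimately show ?thesis
          by simp
      next
        case False
        have "- (\<Sum>k\<in>elems M. X k) \<le> (\<Sum>k\<in>elems M. (\<Sum>\<gamma>\<in>int_facets M k. q \<gamma> k) / 4)"
          unfolding X
        proof (intro sum_mono sum_pairs_bound)
          fix k assume k: "k \<in> elems M"
          show "finite (int_facets M k)"
            using mesh_facts(2)[OF k] by (simp add: int_facets_def)
          show "card (int_facets M k) \<le> 3"
            by (rule mesh_facts(3)[OF k])
          show "0 \<le> q b k" if "b \<in> int_facets M k" for b
            using T1_pd[OF k that] unfolding pd_def q_def by (metis inner_zero_left less_eq_real_def)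
          show "- (j b k \<bullet> (T5 T b c k *v j c k)) \<le> (q b k + q c k) / 16"
            if "b \<in> int_facets M k" "c \<in> int_facets M k" "b \<noteq> c" for b c
            unfolding q_def
          proof (rule weighted_young)
            show "sym_mat (T1 T c k)"
              using sym[OF k that(2)] by blast
            show "pd (T1 T c k)"
              by (rule T1_pd[OF k that(2)])
            show "T5 T c b k = transpose (T5 T b c k)"
              using sym_56[OF k that(2,1)] that(3) by simp
            show "psd (T1 T b k - 64 *\<^sub>R (T5 T b c k ** matrix_inv (T1 T c k) ** T5 T c b k))"
              by (rule cond_T5[OF k that])
          qed
        qed
        moreover have "z = 1"
          using False by (simp add: z_def zeta_def)
        ultimately show ?thesis
          by (simp add: sum_divide_distrib)
      qed
    qed

    have "(\<Sum>k\<in>elems M. u k \<bullet> (Hm S k *v semidiscrete_rhs P M S T t u k)) \<le>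
        (\<Sum>k\<in>elems M. (\<Sum>\<gamma>\<in>int_facets M k. g \<gamma> k) - X k)"
      by (rule sum_mono[OF element])
    also have "\<dots> = (\<Sum>k\<in>elems M. \<Sum>\<gamma>\<in>int_facets M k. g \<gamma> k) - (\<Sum>k\<in>elems M. X k)"
      by (rule sum_subtractf)
    also have "(\<Sum>k\<in>elems M. \<Sum>\<gamma>\<in>int_facets M k. g \<gamma> k) \<le>
        (\<Sum>k\<in>elems M. \<Sum>\<gamma>\<in>int_facets M k. ((z - 2) / 4) * q \<gamma> k)"
      by (intro sum_int_facets_pair_mono mesh_facts(1,2) pair)
    also have "\<dots> = ((z - 2) / 4) * (\<Sum>k\<in>elems M. \<Sum>\<gamma>\<in>int_facets M k. q \<gamma> k)"
      by (simp only: sum_distrib_left)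
    finally show ?thesis
      using coupling by (simp add: field_simps)
  qed
  show ?thesis
    unfolding energy_stable_def
  proof (intro allI impI)
    fix u and t :: real
    assume "semidiscrete_solution P M S T u" "0 \<le> t"
    from energy_has_derivative[OF this sbp_elementD(3)[OF elem]] dissipation[of "u t" t]
    show "\<exists>d\<le>0. ((\<lambda>s. energy M S (u s)) has_real_derivative d) (at t within {0..})"
      by (meson mult_nonneg_nonpos zero_le_numeral)
  qed
qed

end
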